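(* Let $\Omega\subseteq\mathbb{R}^N$ be a bounded open set with $C^1$ boundary and let $s\in(0,1)$. Let $u\in H^1(\mathbb{R}^N)$ weakly satisfy $\mathcal{L}u\ge 0$ in $\Omega$. If $u\ge 0$ a.e. in $\mathbb{R}^N\setminus\Omega$, then $u\ge 0$ a.e. on $\Omega$.
   Context: $\mathcal{L}:=-\Delta+(-\Delta)^s$, where $(-\Delta)^s u(x)=c_{N,s}\,\mathrm{P.V.}\int_{\mathbb{R}^N}\frac{u(x)-u(y)}{|x-y|^{N+2s}}\,dy$ and $c_{N,s}=\Big(\int_{\mathbb{R}^N}\frac{1-\cos(\zeta_1)}{|\zeta|^{N+2s}}\,d\zeta\Big)^{-1}$. $\mathbb{X}(\Omega):=\{u\in H^1(\mathbb{R}^N): u\equiv 0 \text{ a.e. in }\mathbb{R}^N\setminus\Omega\}$. For $f\in L^2(\Omega)$, a function $u\in H^1(\mathbb{R}^N)$ weakly satisfies $\mathcal{L}u\ge f$ in $\Omega$ if for every nonnegative $v\in\mathbb{X}(\Omega)$ $$\int_\Omega\langle\nabla u,\nabla v\rangle\,dx+\frac{c_{N,s}}{2}\int_{\mathbb{R}^N\times\mathbb{R}^N}\frac{(u(x)-u(y))(v(x)-v(y))}{|x-y|^{N+2s}}\,dx\,dy\ge\int_\Omega fv\,dx.$$ *)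

theory Defs
  imports "HOL-Analysis.Analysis"
begin

section \<open>Differentiability classes\<close>

text \<open>Used only for open \<open>S\<close>.\<close>

primrec C_k_on :: "nat \<Rightarrow> 'a::euclidean_space set \<Rightarrow> ('a \<Rightarrow> real) \<Rightarrow> bool" where
  "C_k_on 0 S f \<longleftrightarrow> continuous_on S f"
| "C_k_on (Suc k) S f \<longleftrightarrow> (\<forall>x\<in>S. f differentiable (at x)) \<and>
     (\<forall>v. C_k_on k S (\<lambda>x. frechet_derivative f (at x) v))"

definition test_function :: "('a::euclidean_space \<Rightarrow> real) \<Rightarrow> bool" where
  "test_function \<phi> \<longleftrightarrow> (\<forall>k. C_k_on k UNIV \<phi>) \<and> compact (closure {x. \<phi> x \<noteq> 0})"

text \<open>Near each boundary point, up to a rigid motion, \<open>\<Omega>\<close> is the strict epigraph of a \<open>C\<^sup>1\<close>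
  function \<open>\<gamma>\<close> of \<open>N - 1\<close> variables; the unit vector \<open>e\<close> is the vertical direction. The function
  \<open>\<gamma>\<close> is evaluated only on the hyperplane orthogonal to \<open>e\<close>, on which the \<open>C\<^sup>1\<close> functions are
  exactly the restrictions of \<open>C\<^sup>1\<close> functions on the whole space.\<close>

definition C1_boundary :: "(real^'n) set \<Rightarrow> bool" where
  "C1_boundary \<Omega> \<longleftrightarrow>
     (\<forall>x0 \<in> frontier \<Omega>. \<exists>r>0. \<exists>e \<gamma>. norm e = 1 \<and> C_k_on 1 UNIV \<gamma> \<and>
        \<Omega> \<inter> ball x0 r = {x \<in> ball x0 r. \<gamma> (x - (x \<bullet> e) *\<^sub>R e) < x \<bullet> e})"

section \<open>Sobolev spaces\<close>

text \<open>Elements of the function spaces are everywhere defined representatives, not classes modulo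
  equality almost everywhere.\<close>

definition L2_space :: "'a::euclidean_space set \<Rightarrow> ('a \<Rightarrow> 'b::euclidean_space) set" where
  "L2_space S = {f. set_borel_measurable lebesgue S f \<and>
                    set_integrable lebesgue S (\<lambda>x. (norm (f x))\<^sup>2)}"

definition locally_integrable :: "('a::euclidean_space \<Rightarrow> 'b::euclidean_space) \<Rightarrow> bool" where
  "locally_integrable f \<longleftrightarrow> (\<forall>K. compact K \<longrightarrow> set_integrable lebesgue K f)"

definition has_weak_gradient :: "(real^'n \<Rightarrow> real) \<Rightarrow> (real^'n \<Rightarrow> real^'n) \<Rightarrow> bool" where
  "has_weak_gradient u G \<longleftrightarrow> locally_integrable u \<and> locally_integrable G \<and>
     (\<forall>\<phi>. test_function \<phi> \<longrightarrow> (\<forall>i.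
        (LINT x|lebesgue. u x * frechet_derivative \<phi> (at x) (axis i 1))
          = - (LINT x|lebesgue. G x $ i * \<phi> x)))"

text \<open>The weak gradient is unique only up to null sets. It occurs below only under integrals, whose
  values do not depend on the choice.\<close>

definition weak_gradient :: "(real^'n \<Rightarrow> real) \<Rightarrow> real^'n \<Rightarrow> real^'n" where
  "weak_gradient u = (SOME G. has_weak_gradient u G)"

definition H1_space :: "(real^'n \<Rightarrow> real) set" where
  "H1_space = {u \<in> L2_space UNIV. \<exists>G. has_weak_gradient u G \<and> G \<in> L2_space UNIV}"

definition X_space :: "(real^'n) set \<Rightarrow> (real^'n \<Rightarrow> real) set" where
  "X_space \<Omega> = {u \<in> H1_space. AE x in lebesgue. x \<notin> \<Omega> \<longrightarrow> u x = 0}"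

section \<open>The mixed operator \<open>-\<Delta> + (-\<Delta>)\<^sup>s\<close>\<close>

text \<open>The index type \<open>'n\<close> carries no order, so an arbitrary coordinate plays the role of \<open>\<zeta>\<^sub>1\<close>.
  By symmetry the integral is the same for every coordinate.\<close>

definition frac_const :: "'n::finite itself \<Rightarrow> real \<Rightarrow> real" where
  "frac_const _ s = inverse (LINT \<zeta>|(lebesgue :: (real^'n) measure).
     (1 - cos (\<zeta> $ (SOME i. True))) / norm \<zeta> powr (real CARD('n) + 2 * s))"

text \<open>The nonlocal term is an integral over the product space. For \<open>u\<close> and \<open>v\<close> in \<open>H\<^sup>1\<close> and
  \<open>0 < s < 1\<close> it converges absolutely; on the diagonal, a null set, the integrand is \<open>0\<close>.\<close>

definition mixed_form ::
  "real \<Rightarrow> (real^'n) set \<Rightarrow> (real^'n \<Rightarrow> real) \<Rightarrow> (real^'n \<Rightarrow> real) \<Rightarrow> real" where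
  "mixed_form s \<Omega> u v =
     (LINT x:\<Omega>|lebesgue. weak_gradient u x \<bullet> weak_gradient v x)
     + frac_const TYPE('n) s / 2 *
       (LINT p|(lebesgue :: ((real^'n) \<times> (real^'n)) measure).
          (u (fst p) - u (snd p)) * (v (fst p) - v (snd p))
            / norm (fst p - snd p) powr (real CARD('n) + 2 * s))"

text \<open>\<open>\<L> u \<ge> f\<close> weakly in \<open>\<Omega>\<close>, meant for \<open>u \<in> H1_space\<close> and \<open>f \<in> L2_space \<Omega>\<close>.\<close>

definition weakly_L_ge ::
  "real \<Rightarrow> (real^'n) set \<Rightarrow> (real^'n \<Rightarrow> real) \<Rightarrow> (real^'n \<Rightarrow> real) \<Rightarrow> bool" where
  "weakly_L_ge s \<Omega> u f \<longleftrightarrow>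
     (\<forall>v \<in> X_space \<Omega>. (AE x in lebesgue. 0 \<le> v x) \<longrightarrow>
        mixed_form s \<Omega> u v \<ge> (LINT x:\<Omega>|lebesgue. f x * v x))"

end

theory Submission
  imports Defs
begin

text \<open>The test function is \<open>v = \<Phi> \<circ> u\<close>, where \<open>\<Phi>\<close> is nonincreasing, \<open>C\<^sup>1\<close> with Lipschitz derivative, zero
  on \<open>[0, \<infinity>)\<close> and strictly decreasing on \<open>(-\<infinity>, 0]\<close>. With this \<open>v\<close> the integrand of the nonlocal term
  is pointwise \<open>\<le> 0\<close>, and \<open>\<nabla>u \<bullet> \<nabla>v = \<Phi>'(u) \<bar>\<nabla>u\<bar>\<^sup>2 \<le> 0\<close>, so \<open>weakly_L_ge\<close> forces \<open>\<nabla>v = \<Phi>'(u) \<nabla>u = 0\<close>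
  almost everywhere. Hence \<open>v\<close> is invariant under translations, and as it vanishes off a bounded
  set it is zero. Such a \<open>\<Phi>\<close>, in place of the negative part, keeps the chain rule elementary: it
  follows from the weak \<open>L\<^sup>2\<close> convergence of difference quotients, which in turn rests on the bound
  \<open>\<parallel>u(\<cdot> + h e) - u\<parallel>\<^sub>2 \<le> \<bar>h\<bar> \<parallel>\<partial>\<^sub>e u\<parallel>\<^sub>2\<close> and the density of test functions.\<close>

section \<open>Smooth test functions\<close>

text \<open>The obstacle is the chain rule: the gradient of \<open>v\<close> must be computed from
  that of \<open>u\<close>, which has no pointwise derivative. A Lipschitz \<Phi>' gives the
  remainder bound \<bar>\<Phi>(b) - \<Phi>(a) - \<Phi>'(a) (b - a)\<bar> \<le> M (b - a)^2. Squared
  increments of \<open>u\<close> integrate to at most h^2 times a constant, so after division by h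
  the error is still of order h. The kink of the negative part admits no such bound. Half the square
  of the negative part does, but its slope is unbounded and it may leave L2; cutting the slope at -1
  yields the Huber function. Translation invariance of Lebesgue measure takes the place of
  mollification throughout. Moreover \<open>weak_gradient\<close> is a choice among gradients that
  are a priori only locally integrable. L2 density cannot identify it with the computed one, hence
  the separate fundamental lemma of the calculus of variations.\<close>

lemma C_k_on_Suc_iff:
  assumes "\<And>x. (f has_derivative f' x) (at x)"
  shows "C_k_on (Suc k) UNIV f \<longleftrightarrow> (\<forall>v. C_k_on k UNIV (\<lambda>x. f' x v))"
proof -
  have "frechet_derivative f (at x) = f' x" for x
    using frechet_derivative_at[OF assms] by simp
  then show ?thesis
    using assms by (auto simp: differentiable_def)
qed

lemma C_k_on_has_derivative:
  assumes "C_k_on (Suc k) UNIV f"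
  shows "(f has_derivative frechet_derivative f (at x)) (at x)"
  using assms by (simp add: frechet_derivative_works)

lemma C_k_on_SucD: "C_k_on (Suc k) UNIV f \<Longrightarrow> C_k_on k UNIV f"
proof (induction k arbitrary: f)
  case 0
  then show ?case
    by (auto simp: continuous_on_eq_continuous_at differentiable_imp_continuous_within)
next
  case (Suc k)
  then show ?case by (metis C_k_on.simps(2))
qed

lemma C_k_on_const: "C_k_on k UNIV (\<lambda>x. c)"
proof (induction k arbitrary: c)
  case (Suc k)
  show ?case
    by (subst C_k_on_Suc_iff[where f' = "\<lambda>x v. 0"]) (auto intro: Suc)
qed simp

lemma C_k_on_add:
  "C_k_on k UNIV f \<Longrightarrow> C_k_on k UNIV g \<Longrightarrow> C_k_on k UNIV (\<lambda>x. f x + g x)"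
proof (induction k arbitrary: f g)
  case 0
  then show ?case by (auto intro: continuous_intros)
next
  case (Suc k)
  show ?case
  proof (subst C_k_on_Suc_iff)
    show "((\<lambda>x. f x + g x) has_derivative
        (\<lambda>v. frechet_derivative f (at x) v + frechet_derivative g (at x) v)) (at x)" for x
      by (intro has_derivative_add C_k_on_has_derivative[OF Suc.prems(1)] C_k_on_has_derivative[OF Suc.prems(2)])
  qed (use Suc in auto)
qed

lemma C_k_on_mult:
  "C_k_on k UNIV f \<Longrightarrow> C_k_on k UNIV g \<Longrightarrow> C_k_on k UNIV (\<lambda>x. f x * g x)"
proof (induction k arbitrary: f g)
  case 0
  then show ?case by (auto intro: continuous_intros)
next
  case (Suc k)
  show ?case
  proof (subst C_k_on_Suc_iff)
    show "((\<lambda>x. f x * g x) has_derivative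
        (\<lambda>v. f x * frechet_derivative g (at x) v + frechet_derivative f (at x) v * g x)) (at x)" for x
      by (intro has_derivative_mult C_k_on_has_derivative[OF Suc.prems(1)] C_k_on_has_derivative[OF Suc.prems(2)])
    \<comment> \<open>Each Leibniz term keeps one undifferentiated factor, which has to be lowered
      to class \<open>k\<close> before the induction hypothesis applies.\<close>
    show "\<forall>v. C_k_on k UNIV (\<lambda>x. f x * frechet_derivative g (at x) v + frechet_derivative f (at x) v * g x)"
      using Suc.prems C_k_on_SucD[OF Suc.prems(1)] C_k_on_SucD[OF Suc.prems(2)]
      by (intro allI C_k_on_add Suc.IH) auto
  qed
qed

lemma C_k_on_prod:
  assumes "\<And>i. i \<in> I \<Longrightarrow> C_k_on k UNIV (f i)"
  shows "C_k_on k UNIV (\<lambda>x. \<Prod>i\<in>I. f i x)"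
  using assms by (induction I rule: infinite_finite_induct) (auto intro: C_k_on_const C_k_on_mult)

lemma has_derivative_shift:
  assumes "C_k_on (Suc k) UNIV f"
  shows "((\<lambda>x. f (x + a)) has_derivative frechet_derivative f (at (x + a))) (at x)"
proof -
  have "(f has_derivative frechet_derivative f (at (x + a))) (at (x + a))"
    by (rule C_k_on_has_derivative[OF assms])
  then show ?thesis
    by (rule has_derivative_compose[rotated]) (auto intro!: derivative_eq_intros)
qed

lemma C_k_on_shift: "C_k_on k UNIV f \<Longrightarrow> C_k_on k UNIV (\<lambda>x. f (x + a))"
proof (induction k arbitrary: f)
  case 0
  then show ?case
    by (auto intro!: continuous_on_compose2[of UNIV f] continuous_intros)
next
  case (Suc k)
  show ?case
    by (subst C_k_on_Suc_iff[OF has_derivative_shift[OF Suc.prems]])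
       (use Suc.prems in \<open>auto intro: Suc.IH\<close>)
qed

section \<open>Smooth bumps built from exp(-1/t)\<close>

definition flat :: "nat \<Rightarrow> real \<Rightarrow> real" where
  "flat k t = (if t > 0 then (1 / t) ^ k * exp (- (1 / t)) else 0)"

lemma flat_tendsto_0: "(flat k \<longlongrightarrow> 0) (at_right 0)"
proof -
  have "((\<lambda>s::real. s ^ k / exp s) \<longlongrightarrow> 0) at_top"
    by (rule tendsto_power_div_exp_0)
  then have "((\<lambda>t. inverse t ^ k / exp (inverse t)) \<longlongrightarrow> (0::real)) (at_right 0)"
    by (rule filterlim_compose[OF _ filterlim_inverse_at_top_right])
  moreover have "\<forall>\<^sub>F t in at_right 0. inverse t ^ k / exp (inverse t) = flat k t"
    using eventually_at_right_less[of 0]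
    by eventually_elim (simp add: flat_def exp_minus field_simps)
  ultimately show ?thesis
    by (rule Lim_transform_eventually)
qed

text \<open>The powers of 1/t in \<open>flat\<close> are there to make the family closed under
  differentiation up to linear combinations. At the origin the right difference quotient of
  \<open>flat k\<close> is \<open>flat (k + 1)\<close> itself, which tends to 0.\<close>

lemma flat_DERIV: "(flat k has_real_derivative flat (k + 2) t - k * flat (k + 1) t) (at t)"
proof (cases t "0::real" rule: linorder_cases)
  case less
  have "((\<lambda>t. 0) has_real_derivative 0) (at t)" by simp
  then have "(flat k has_real_derivative 0) (at t)"
    by (rule has_field_derivative_transform_within_open[where S="{..<0}"])
       (use less in \<open>auto simp: flat_def\<close>)
  with less show ?thesis by (simp add: flat_def)
next
  case equal
  have left: "((\<lambda>h. (flat k h - flat k 0) / h) \<longlongrightarrow> 0) (at_left 0)"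
    by (rule tendsto_eventually) (auto simp: flat_def eventually_at_filter)
  have "\<forall>\<^sub>F h in at_right 0. flat (k + 1) h = (flat k h - flat k 0) / h"
    using eventually_at_right_less[of 0] by eventually_elim (simp add: flat_def field_simps)
  with flat_tendsto_0 have "((\<lambda>h. (flat k h - flat k 0) / h) \<longlongrightarrow> 0) (at_right 0)"
    by (rule Lim_transform_eventually)
  with left have "((\<lambda>h. (flat k h - flat k 0) / h) \<longlongrightarrow> 0) (at 0)"
    by (simp add: filterlim_split_at)
  with equal show ?thesis
    by (simp add: DERIV_def flat_def)
next
  case greater
  have "((\<lambda>t. (1 / t) ^ k * exp (- (1 / t))) has_real_derivative
      (k * (1 / t) ^ (k - 1) * (- (1 / t^2))) * exp (- (1 / t)) + (1 / t) ^ k * (exp (- (1 / t)) * (1 / t^2))) (at t)"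
    using greater by (auto intro!: derivative_eq_intros simp: power2_eq_square)
  \<comment> \<open>For \<open>k = 0\<close> the exponent \<open>k - 1\<close> is truncated, but the
    factor \<open>k\<close> kills both sides.\<close>
  moreover have *: "k * (1 / t) ^ (k - 1) * (- (1 / t^2)) = - k * (1 / t) ^ (k + 1)"
    using greater by (cases k) (auto simp: field_simps power2_eq_square)
  ultimately have "((\<lambda>t. (1 / t) ^ k * exp (- (1 / t))) has_real_derivative
      - k * (1 / t) ^ (k + 1) * exp (- (1 / t)) + (1 / t) ^ k * (exp (- (1 / t)) * (1 / t^2))) (at t)"
    by (simp only: *)
  then have "((\<lambda>t. (1 / t) ^ k * exp (- (1 / t))) has_real_derivative
      flat (k + 2) t - k * flat (k + 1) t) (at t)"
    by (rule DERIV_cong) (use greater in \<open>simp add: flat_def power_divide power_add algebra_simps power2_eq_square\<close>)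
  then show ?thesis
    by (rule has_field_derivative_transform_within_open[where S="{0<..}"])
       (use greater in \<open>auto simp: flat_def\<close>)
qed

text \<open>Differentiation raises the index of \<open>flat\<close> while lowering \<open>m\<close>,
  so the induction on \<open>m\<close> must leave \<open>k\<close> arbitrary.\<close>

lemma C_k_on_flat_affine: "C_k_on m UNIV (\<lambda>x. flat k (w \<bullet> x + c))"
proof (induction m arbitrary: k)
  case 0
  have "continuous_on UNIV (flat k)"
    using flat_DERIV by (rule DERIV_continuous_on)
  then show ?case
    by (auto intro!: continuous_on_compose2[of UNIV "flat k"] continuous_intros)
next
  case (Suc m)
  have "((\<lambda>x. flat k (w \<bullet> x + c)) has_derivative
      (\<lambda>v. (w \<bullet> v) * flat (k + 2) (w \<bullet> x + c) + (w \<bullet> v) * ((- real k) * flat (k + 1) (w \<bullet> x + c)))) (at x)" for x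
  proof -
    have "((\<lambda>x. w \<bullet> x + c) has_derivative (\<lambda>v. w \<bullet> v)) (at x)"
      by (auto intro!: derivative_eq_intros)
    from has_derivative_compose[OF this flat_DERIV[unfolded has_field_derivative_def]] show ?thesis
      by (rule has_derivative_eq_rhs) (auto simp: algebra_simps)
  qed
  then show ?case
    by (subst C_k_on_Suc_iff, assumption) (intro allI C_k_on_add C_k_on_mult C_k_on_const Suc)
qed

lemma flat_0_bounds: "0 \<le> flat 0 t" "flat 0 t \<le> 1"
  by (auto simp: flat_def)

lemma flat_0_scaled_LIMSEQ: "(\<lambda>n. flat 0 (of_nat (Suc n) * t)) \<longlonglongrightarrow> (if t > 0 then 1 else 0)"
proof (cases "t > 0")
  case True
  have "(\<lambda>n. 1 / (real (Suc n) * t)) \<longlonglongrightarrow> 0"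
    using tendsto_mult[OF tendsto_const[of "1/t"] LIMSEQ_inverse_real_of_nat]
    by (simp add: field_simps)
  then have "(\<lambda>n. exp (- (1 / (real (Suc n) * t)))) \<longlonglongrightarrow> exp (- 0)"
    by (intro tendsto_intros)
  with True show ?thesis by (simp add: flat_def)
next
  case False
  then show ?thesis
    by (auto simp: flat_def zero_less_mult_iff)
qed

text \<open>\<open>exp (- 1 / (m t))\<close> increases to \<open>1\<close> for \<open>t > 0\<close> as \<open>m\<close> grows, so no normalisation is needed.\<close>

definition box_bump :: "nat \<Rightarrow> 'a::euclidean_space \<Rightarrow> 'a \<Rightarrow> 'a \<Rightarrow> real" where
  "box_bump n a c x = (\<Prod>b\<in>Basis. flat 0 (of_nat (Suc n) * (x \<bullet> b - a \<bullet> b)) * flat 0 (of_nat (Suc n) * (c \<bullet> b - x \<bullet> b)))"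

lemma box_bump_outside: "x \<notin> box a c \<Longrightarrow> box_bump n a c x = 0"
  by (force simp: box_bump_def mem_box flat_def zero_less_mult_iff)

lemma box_bump_bounds: "0 \<le> box_bump n a c x" "box_bump n a c x \<le> 1"
  unfolding box_bump_def
  by (auto intro!: prod_nonneg prod_le_1 mult_nonneg_nonneg mult_le_one simp: flat_0_bounds)

lemma box_bump_LIMSEQ: "(\<lambda>n. box_bump n a c x) \<longlonglongrightarrow> indicator (box a c) x"
proof -
  have "(\<lambda>n. box_bump n a c x) \<longlonglongrightarrow>
      (\<Prod>b\<in>Basis. (if x \<bullet> b - a \<bullet> b > 0 then 1 else 0) * (if c \<bullet> b - x \<bullet> b > 0 then 1 else 0))"
    unfolding box_bump_def by (intro tendsto_prod tendsto_mult flat_0_scaled_LIMSEQ)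
  moreover have "(\<Prod>b\<in>Basis. (if x \<bullet> b - a \<bullet> b > 0 then 1 else 0) * (if c \<bullet> b - x \<bullet> b > 0 then 1 else 0))
     = (indicator (box a c) x :: real)"
    by (cases "x \<in> box a c") (auto simp: mem_box)
  ultimately show ?thesis by simp
qed

lemma test_function_box_bump: "test_function (box_bump n a c)"
  unfolding test_function_def
proof
  show "\<forall>k. C_k_on k UNIV (box_bump n a c)"
  proof
    fix k
    have "C_k_on k UNIV (\<lambda>x. flat 0 (of_nat (Suc n) * (x \<bullet> b - a \<bullet> b)))"
      "C_k_on k UNIV (\<lambda>x. flat 0 (of_nat (Suc n) * (c \<bullet> b - x \<bullet> b)))" for b
      using C_k_on_flat_affine[of k 0 "of_nat (Suc n) *\<^sub>R b" "- of_nat (Suc n) * (a \<bullet> b)"]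
        C_k_on_flat_affine[of k 0 "- of_nat (Suc n) *\<^sub>R b" "of_nat (Suc n) * (c \<bullet> b)"]
      by (simp_all add: algebra_simps inner_commute)
    then show "C_k_on k UNIV (box_bump n a c)"
      unfolding box_bump_def[abs_def] by (intro C_k_on_prod C_k_on_mult)
  qed
  have "{x. box_bump n a c x \<noteq> 0} \<subseteq> box a c"
    using box_bump_outside by blast
  then show "compact (closure {x. box_bump n a c x \<noteq> 0})"
    by (meson bounded_box bounded_subset compact_closure)
qed

lemma test_function_0: "test_function (\<lambda>x. 0)"
  by (simp add: test_function_def C_k_on_const)

lemma test_function_add:
  assumes "test_function f" "test_function g"
  shows "test_function (\<lambda>x. f x + g x)"
proof -
  have "{x. f x + g x \<noteq> 0} \<subseteq> {x. f x \<noteq> 0} \<union> {x. g x \<noteq> 0}" by auto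
  then have "bounded {x. f x + g x \<noteq> 0}"
    by (rule bounded_subset[rotated]) (use assms in \<open>simp add: test_function_def\<close>)
  with assms show ?thesis
    by (simp add: test_function_def C_k_on_add)
qed

lemma test_function_cmult:
  assumes "test_function f"
  shows "test_function (\<lambda>x. c * f x)"
proof -
  have "{x. c * f x \<noteq> 0} \<subseteq> {x. f x \<noteq> 0}" by auto
  then have "bounded {x. c * f x \<noteq> 0}"
    by (rule bounded_subset[rotated]) (use assms in \<open>simp add: test_function_def\<close>)
  with assms show ?thesis
    by (simp add: test_function_def C_k_on_mult C_k_on_const)
qed

lemma test_function_shift:
  assumes "test_function f"
  shows "test_function (\<lambda>x. f (x + a))"
proof -
  have "{x. f (x + a) \<noteq> 0} = (\<lambda>x. x - a) ` {x. f x \<noteq> 0}"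
    by (force simp: image_iff)
  with assms show ?thesis
    unfolding test_function_def compact_closure
    by (simp add: C_k_on_shift bounded_translation_minus)
qed

lemma test_function_frechet_derivative:
  assumes "test_function f"
  shows "(f has_derivative frechet_derivative f (at x)) (at x)"
  by (rule C_k_on_has_derivative[of 0]) (use assms in \<open>simp add: test_function_def del: C_k_on.simps\<close>)

lemma test_function_support:
  assumes "test_function f"
  obtains r where "r > 0" "\<And>x. norm x \<ge> r \<Longrightarrow> f x = 0"
proof -
  have "bounded {x. f x \<noteq> 0}"
    using assms by (simp add: test_function_def compact_closure)
  then obtain r where "r > 0" "\<And>x. f x \<noteq> 0 \<Longrightarrow> norm x < r"
    by (auto simp: bounded_pos_less)
  then show ?thesis
    by (meson not_le that)
qed

lemma test_function_derivative_bounded: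
  assumes "test_function f"
  obtains B where "B > 0" "\<And>x. \<bar>frechet_derivative f (at x) v\<bar> \<le> B"
proof -
  obtain r where r: "r > 0" "\<And>x. norm x \<ge> r \<Longrightarrow> f x = 0"
    using test_function_support[OF assms] by blast
  let ?g = "\<lambda>x. frechet_derivative f (at x) v"
  have "C_k_on (Suc 0) UNIV f"
    using assms by (simp add: test_function_def del: C_k_on.simps)
  then have "continuous_on UNIV ?g"
    by simp
  then have "compact (?g ` cball 0 r)"
    by (meson compact_cball compact_continuous_image continuous_on_subset top_greatest)
  then obtain B where B: "B > 0" "\<And>x. norm x \<le> r \<Longrightarrow> \<bar>?g x\<bar> \<le> B"
    by (auto dest!: compact_imp_bounded simp: bounded_pos)
  have "\<bar>?g x\<bar> \<le> B" for x
  proof (cases "norm x \<le> r")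
    case False
    \<comment> \<open>The complement of the closed ball is open, so \<open>f\<close> agrees with the
      zero function near \<open>x\<close>.\<close>
    have "((\<lambda>x. 0) has_derivative (\<lambda>v. 0)) (at x)" by simp
    then have "(f has_derivative (\<lambda>v. 0)) (at x)"
      by (rule has_derivative_transform_within_open[where s = "- cball 0 r"])
         (use False r in \<open>auto simp: open_Compl\<close>)
    then have "frechet_derivative f (at x) = (\<lambda>v. 0)"
      using frechet_derivative_at by metis
    with B show ?thesis by simp
  qed (use B in auto)
  with B that show ?thesis by blast
qed

lemma test_function_bounded:
  assumes "test_function f"
  obtains B where "B > 0" "\<And>x. \<bar>f x\<bar> \<le> B"
proof -
  obtain r where r: "r > 0" "\<And>x. norm x \<ge> r \<Longrightarrow> f x = 0"
    using test_function_support[OF assms] by blast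
  have "C_k_on 0 UNIV f"
    using assms by (simp add: test_function_def del: C_k_on.simps)
  then have "continuous_on UNIV f" by simp
  then have "compact (f ` cball 0 r)"
    by (meson compact_cball compact_continuous_image continuous_on_subset top_greatest)
  then obtain B where B: "B > 0" "\<And>x. norm x \<le> r \<Longrightarrow> \<bar>f x\<bar> \<le> B"
    by (auto dest!: compact_imp_bounded simp: bounded_pos)
  with r have "\<bar>f x\<bar> \<le> B" for x
    by (cases "norm x \<le> r") auto
  with B that show ?thesis by blast
qed

lemma test_function_continuous:
  assumes "test_function f" shows "continuous_on UNIV f"
  using assms C_k_on.simps(1) unfolding test_function_def by blast

lemma test_function_continuous_derivative:
  assumes "test_function f" shows "continuous_on UNIV (\<lambda>x. frechet_derivative f (at x) v)"
proof -
  have "C_k_on (Suc 0) UNIV f"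
    using assms by (simp add: test_function_def del: C_k_on.simps)
  then show ?thesis by simp
qed

section \<open>Square integrable functions and density of test functions\<close>

lemma measurable_lebesgue_shift: "(\<lambda>x. x + a) \<in> lebesgue \<rightarrow>\<^sub>M (lebesgue :: 'a::euclidean_space measure)"
  using lebesgue_affine_measurable[of "\<lambda>_. 1" a] by (simp add: euclidean_representation add.commute)

lemma distr_lebesgue_shift: "distr lebesgue lebesgue (\<lambda>x. x + a) = (lebesgue :: 'a::euclidean_space measure)"
  using lebesgue_affine_euclidean[of "\<lambda>_. 1" a]
  by (simp add: euclidean_representation add.commute density_1)

lemma AE_lebesgue_shift:
  fixes a :: "'a::euclidean_space"
  assumes "AE x in lebesgue. P x"
  shows "AE x in lebesgue. P (x + a)"
  using AE_distrD[OF measurable_lebesgue_shift[of a], of P] assms unfolding distr_lebesgue_shift by blast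

lemma borel_measurable_lebesgue_shift:
  fixes f :: "'a::euclidean_space \<Rightarrow> 'b::euclidean_space"
  assumes "f \<in> borel_measurable lebesgue"
  shows "(\<lambda>x. f (x + a)) \<in> borel_measurable lebesgue"
  using measurable_compose[OF measurable_lebesgue_shift assms] .

lemma integral_lebesgue_shift:
  fixes f :: "'a::euclidean_space \<Rightarrow> 'b::euclidean_space"
  assumes "f \<in> borel_measurable lebesgue"
  shows "(LINT x|lebesgue. f (x + a)) = (LINT x|lebesgue. f x)"
  using integral_distr[OF measurable_lebesgue_shift[of a] assms] by (simp add: distr_lebesgue_shift)

lemma integrable_lebesgue_shift:
  fixes f :: "'a::euclidean_space \<Rightarrow> 'b::euclidean_space"
  assumes "integrable lebesgue f"
  shows "integrable lebesgue (\<lambda>x. f (x + a))"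
  using integrable_distr[OF measurable_lebesgue_shift[of a], of f] assms by (simp add: distr_lebesgue_shift)

lemma L2_space_UNIV_iff:
  "f \<in> L2_space UNIV \<longleftrightarrow> f \<in> borel_measurable lebesgue \<and> integrable lebesgue (\<lambda>x. (norm (f x))\<^sup>2)"
  by (simp add: L2_space_def set_borel_measurable_def set_integrable_def)

lemma L2_measurable: "f \<in> L2_space UNIV \<Longrightarrow> f \<in> borel_measurable lebesgue"
  by (simp add: L2_space_UNIV_iff)

lemma L2_square_integrable:
  fixes f :: "'a::euclidean_space \<Rightarrow> real"
  shows "f \<in> L2_space UNIV \<Longrightarrow> integrable lebesgue (\<lambda>x. (f x)\<^sup>2)"
  by (simp add: L2_space_UNIV_iff)

lemma L2_dominated:
  fixes f :: "'a::euclidean_space \<Rightarrow> 'b::euclidean_space" and g :: "'a \<Rightarrow> 'c::euclidean_space"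
  assumes "g \<in> L2_space UNIV" "f \<in> borel_measurable lebesgue"
    and "AE x in lebesgue. norm (f x) \<le> C * norm (g x)"
  shows "f \<in> L2_space UNIV"
proof -
  have "integrable lebesgue (\<lambda>x. C\<^sup>2 * (norm (g x))\<^sup>2)"
    using assms(1) by (simp add: L2_space_UNIV_iff)
  then have "integrable lebesgue (\<lambda>x. (norm (f x))\<^sup>2)"
  proof (rule Bochner_Integration.integrable_bound)
    show "AE x in lebesgue. norm ((norm (f x))\<^sup>2) \<le> norm (C\<^sup>2 * (norm (g x))\<^sup>2)"
      using assms(3)
    proof eventually_elim
      case (elim x)
      then show ?case
        using power_mono[OF elim, of 2] by (simp add: power_mult_distrib)
    qed
  qed (use assms(2) in measurable)
  with assms(2) show ?thesis by (simp add: L2_space_UNIV_iff)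
qed

lemma L2_mult_integrable:
  fixes f g :: "'a::euclidean_space \<Rightarrow> real"
  assumes "f \<in> L2_space UNIV" "g \<in> L2_space UNIV"
  shows "integrable lebesgue (\<lambda>x. f x * g x)"
proof (rule Bochner_Integration.integrable_bound)
  show "integrable lebesgue (\<lambda>x. (f x)\<^sup>2 + (g x)\<^sup>2)"
    using assms by (auto simp: L2_space_UNIV_iff)
  have "\<bar>a * b\<bar> \<le> a\<^sup>2 + b\<^sup>2" for a b :: real
    using sum_squares_bound[of "\<bar>a\<bar>" "\<bar>b\<bar>"] mult_nonneg_nonneg[of "\<bar>a\<bar>" "\<bar>b\<bar>"]
    unfolding abs_mult power2_abs by linarith
  then show "AE x in lebesgue. norm (f x * g x) \<le> norm ((f x)\<^sup>2 + (g x)\<^sup>2)" by simp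
qed (use assms in \<open>auto simp: L2_space_UNIV_iff\<close>)

lemma L2_cmult:
  fixes f :: "'a::euclidean_space \<Rightarrow> real"
  assumes "f \<in> L2_space UNIV"
  shows "(\<lambda>x. c * f x) \<in> L2_space UNIV"
  using assms by (auto simp: L2_space_UNIV_iff power_mult_distrib)

lemma L2_add:
  fixes f g :: "'a::euclidean_space \<Rightarrow> real"
  assumes "f \<in> L2_space UNIV" "g \<in> L2_space UNIV"
  shows "(\<lambda>x. f x + g x) \<in> L2_space UNIV"
  using assms L2_mult_integrable[OF assms] by (auto simp: L2_space_UNIV_iff power2_sum mult.assoc)

lemma L2_diff:
  fixes f g :: "'a::euclidean_space \<Rightarrow> real"
  assumes "f \<in> L2_space UNIV" "g \<in> L2_space UNIV"
  shows "(\<lambda>x. f x - g x) \<in> L2_space UNIV"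
  using L2_add[OF assms(1) L2_cmult[OF assms(2), of "-1"]] by simp

lemma L2_shift:
  fixes f :: "'a::euclidean_space \<Rightarrow> real"
  assumes "f \<in> L2_space UNIV"
  shows "(\<lambda>x. f (x + a)) \<in> L2_space UNIV"
  using assms integrable_lebesgue_shift[of "\<lambda>x. (f x)\<^sup>2" a]
  by (simp add: L2_space_UNIV_iff borel_measurable_lebesgue_shift)

lemma L2_indicator: "A \<in> sets lebesgue \<Longrightarrow> emeasure lebesgue A < \<infinity> \<Longrightarrow> (indicator A :: _ \<Rightarrow> real) \<in> L2_space UNIV"
  by (auto simp: L2_space_UNIV_iff power2_eq_square simp flip: indicator_inter_arith)

text \<open>On a compact set, which has finite measure, t \<le> 1 + t^2 bounds
  \<open>norm (f x)\<close> by an integrable function.\<close>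

lemma L2_locally_integrable:
  fixes f :: "'a::euclidean_space \<Rightarrow> 'b::euclidean_space"
  assumes "f \<in> L2_space UNIV"
  shows "locally_integrable f"
  unfolding locally_integrable_def set_integrable_def
proof (intro allI impI)
  fix K :: "'a set" assume K: "compact K"
  then have [measurable]: "K \<in> sets lebesgue" by (simp add: lmeasurable_compact fmeasurableD)
  have "emeasure lebesgue K < \<infinity>"
    using emeasure_bounded_finite[OF compact_imp_bounded[OF K]] K by (simp add: borel_compact)
  then have "integrable lebesgue (\<lambda>x. indicator K x + (norm (f x))\<^sup>2)"
    using assms by (auto simp: L2_space_UNIV_iff)
  then show "integrable lebesgue (\<lambda>x. indicat_real K x *\<^sub>R f x)"
  proof (rule Bochner_Integration.integrable_bound)
    have "t \<le> 1 + t\<^sup>2" for t :: real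
      using sum_squares_bound[of t 1] zero_le_power2[of t] by (simp; linarith)
    then show "AE x in lebesgue. norm (indicat_real K x *\<^sub>R f x) \<le> norm (indicat_real K x + (norm (f x))\<^sup>2)"
      by (auto simp: indicator_def)
  qed (use L2_measurable[OF assms] in measurable)
qed

section \<open>Test functions in L2 and their density\<close>

lemma test_function_measurable: "test_function f \<Longrightarrow> f \<in> borel_measurable lebesgue"
  using test_function_continuous borel_measurable_continuous_onI measurable_completion
  by (metis measurable_lborel2)

lemma test_function_derivative_measurable:
  "test_function f \<Longrightarrow> (\<lambda>x. frechet_derivative f (at x) v) \<in> borel_measurable lebesgue"
  using test_function_continuous_derivative borel_measurable_continuous_onI measurable_completion
  by (metis measurable_lborel2)

lemma test_function_L2:
  assumes "test_function f"
  shows "f \<in> L2_space UNIV"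
proof -
  obtain r where r: "\<And>x. norm x \<ge> r \<Longrightarrow> f x = 0"
    using test_function_support[OF assms] by blast
  obtain B where B: "\<And>x. \<bar>f x\<bar> \<le> B"
    using test_function_bounded[OF assms] by blast
  have "indicat_real (ball 0 r) \<in> L2_space UNIV"
    using emeasure_bounded_finite[OF bounded_ball] by (intro L2_indicator) auto
  then show ?thesis
    by (rule L2_dominated[where C = B])
       (use r B test_function_measurable[OF assms] in \<open>auto simp: indicator_def\<close>)
qed

text \<open>Density is phrased for one function at a time, so that it can be carried through a
  measure-theoretic induction. The Bochner integral of a nonintegrable function is 0, so the
  property is meaningful only together with membership in \<open>L2_space UNIV\<close>.\<close>

definition test_approximable :: "('a::euclidean_space \<Rightarrow> real) \<Rightarrow> bool" where
  "test_approximable f \<longleftrightarrow>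
    (\<forall>e>0. \<exists>\<phi>. test_function \<phi> \<and> (LINT x|lebesgue. (f x - \<phi> x)\<^sup>2) < e)"

lemma test_approximable_test_function: "test_function f \<Longrightarrow> test_approximable f"
  by (auto simp: test_approximable_def intro!: exI[of _ f])

text \<open>Replaces the triangle inequality while staying with squared norms. Its factor 2 is the
  origin of the thresholds \<open>e / 4\<close> below.\<close>

lemma integral_square_sum_le:
  fixes f g :: "'a::euclidean_space \<Rightarrow> real"
  assumes "f \<in> L2_space UNIV" "g \<in> L2_space UNIV"
  shows "(LINT x|lebesgue. (f x + g x)\<^sup>2) \<le> 2 * (LINT x|lebesgue. (f x)\<^sup>2) + 2 * (LINT x|lebesgue. (g x)\<^sup>2)"
proof -
  have "(LINT x|lebesgue. (f x + g x)\<^sup>2) \<le> (LINT x|lebesgue. 2 * (f x)\<^sup>2 + 2 * (g x)\<^sup>2)"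
  proof (rule integral_mono)
    show "(f x + g x)\<^sup>2 \<le> 2 * (f x)\<^sup>2 + 2 * (g x)\<^sup>2" for x
      using sum_squares_bound[of "f x" "g x"] by (simp add: power2_sum)
  qed (use assms L2_square_integrable[OF L2_add[OF assms]] in \<open>auto simp: L2_square_integrable\<close>)
  also have "\<dots> = 2 * (LINT x|lebesgue. (f x)\<^sup>2) + 2 * (LINT x|lebesgue. (g x)\<^sup>2)"
    using assms by (simp add: L2_square_integrable)
  finally show ?thesis .
qed

lemma test_approximable_lim:
  assumes f: "f \<in> L2_space UNIV" and fn: "\<And>n. f' n \<in> L2_space UNIV" "\<And>n. test_approximable (f' n)"
    and lim: "(\<lambda>n. LINT x|lebesgue. (f x - f' n x)\<^sup>2) \<longlonglongrightarrow> 0"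
  shows "test_approximable f"
  unfolding test_approximable_def
proof (intro allI impI)
  fix e :: real assume e: "e > 0"
  then have "\<forall>\<^sub>F n in sequentially. (LINT x|lebesgue. (f x - f' n x)\<^sup>2) < e / 4"
    using lim by (intro order_tendstoD) auto
  then obtain n where n: "(LINT x|lebesgue. (f x - f' n x)\<^sup>2) < e / 4"
    by (auto simp: eventually_sequentially)
  obtain \<phi> where \<phi>: "test_function \<phi>" "(LINT x|lebesgue. (f' n x - \<phi> x)\<^sup>2) < e / 4"
    using fn(2)[of n] e unfolding test_approximable_def by (meson divide_pos_pos zero_less_numeral)
  have "(LINT x|lebesgue. (f x - \<phi> x)\<^sup>2) \<le> 2 * (LINT x|lebesgue. (f x - f' n x)\<^sup>2) + 2 * (LINT x|lebesgue. (f' n x - \<phi> x)\<^sup>2)"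
    using integral_square_sum_le[OF L2_diff[OF f fn(1)[of n]] L2_diff[OF fn(1)[of n] test_function_L2[OF \<phi>(1)]]]
    by simp
  also have "\<dots> < e" using n \<phi> by simp
  finally show "\<exists>\<phi>. test_function \<phi> \<and> (LINT x|lebesgue. (f x - \<phi> x)\<^sup>2) < e"
    using \<phi>(1) by blast
qed

text \<open>Dominated convergence: the squared difference is at most 2 f^2 + 2 g^2.\<close>

lemma L2_dominated_LIMSEQ:
  fixes f g :: "'a::euclidean_space \<Rightarrow> real"
  assumes f: "f \<in> L2_space UNIV" and g: "g \<in> L2_space UNIV" and fn: "\<And>n. f' n \<in> L2_space UNIV"
    and dom: "\<And>n. AE x in lebesgue. \<bar>f' n x\<bar> \<le> \<bar>g x\<bar>"
    and lim: "AE x in lebesgue. (\<lambda>n. f' n x) \<longlonglongrightarrow> f x"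
  shows "(\<lambda>n. LINT x|lebesgue. (f x - f' n x)\<^sup>2) \<longlonglongrightarrow> 0"
proof -
  have "(\<lambda>n. LINT x|lebesgue. (f x - f' n x)\<^sup>2) \<longlonglongrightarrow> (LINT x|(lebesgue::'a measure). 0)"
  proof (rule integral_dominated_convergence)
    show "integrable lebesgue (\<lambda>x. 2 * (f x)\<^sup>2 + 2 * (g x)\<^sup>2)"
      using f g by (simp add: L2_square_integrable)
    show "AE x in lebesgue. norm ((f x - f' n x)\<^sup>2) \<le> 2 * (f x)\<^sup>2 + 2 * (g x)\<^sup>2" for n
      using dom[of n]
    proof eventually_elim
      case (elim x)
      then have "(f' n x)\<^sup>2 \<le> (g x)\<^sup>2" by (simp add: abs_le_square_iff)
      then show ?case
        using sum_squares_bound[of "f x" "- f' n x"] zero_le_power2[of "f x - f' n x"]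
        unfolding real_norm_def abs_of_nonneg[OF zero_le_power2] by (simp add: power2_diff)
    qed
    show "AE x in lebesgue. (\<lambda>n. (f x - f' n x)\<^sup>2) \<longlonglongrightarrow> 0"
      using lim
    proof eventually_elim
      case (elim x)
      then have "(\<lambda>n. (f x - f' n x)\<^sup>2) \<longlonglongrightarrow> (f x - f x)\<^sup>2" by (intro tendsto_intros)
      then show ?case by simp
    qed
  qed (use L2_measurable[OF f] L2_measurable[OF fn] in measurable)
  then show ?thesis by simp
qed

lemma test_approximable_dominated:
  assumes "f \<in> L2_space UNIV" "g \<in> L2_space UNIV" "\<And>n. f' n \<in> L2_space UNIV"
    and "\<And>n. test_approximable (f' n)"
    and "\<And>n. AE x in lebesgue. \<bar>f' n x\<bar> \<le> \<bar>g x\<bar>"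
    and "AE x in lebesgue. (\<lambda>n. f' n x) \<longlonglongrightarrow> f x"
  shows "test_approximable f"
  using test_approximable_lim[OF assms(1,3,4) L2_dominated_LIMSEQ[OF assms(1,2,3,5,6)]] .

lemma test_approximable_add:
  assumes f: "f \<in> L2_space UNIV" "test_approximable f" and g: "g \<in> L2_space UNIV" "test_approximable g"
  shows "test_approximable (\<lambda>x. f x + g x)"
  unfolding test_approximable_def
proof (intro allI impI)
  fix e :: real assume e: "e > 0"
  obtain \<phi> where \<phi>: "test_function \<phi>" "(LINT x|lebesgue. (f x - \<phi> x)\<^sup>2) < e / 4"
    using f(2) e unfolding test_approximable_def by (meson divide_pos_pos zero_less_numeral)
  obtain \<psi> where \<psi>: "test_function \<psi>" "(LINT x|lebesgue. (g x - \<psi> x)\<^sup>2) < e / 4"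
    using g(2) e unfolding test_approximable_def by (meson divide_pos_pos zero_less_numeral)
  have "(LINT x|lebesgue. ((f x + g x) - (\<phi> x + \<psi> x))\<^sup>2) < e"
    using integral_square_sum_le[OF L2_diff[OF f(1) test_function_L2[OF \<phi>(1)]] L2_diff[OF g(1) test_function_L2[OF \<psi>(1)]]]
      \<phi>(2) \<psi>(2) by (simp add: algebra_simps)
  then show "\<exists>\<phi>. test_function \<phi> \<and> (LINT x|lebesgue. (f x + g x - \<phi> x)\<^sup>2) < e"
    using test_function_add[OF \<phi>(1) \<psi>(1)] by blast
qed

lemma test_approximable_cmult:
  assumes f: "f \<in> L2_space UNIV" "test_approximable f"
  shows "test_approximable (\<lambda>x. c * f x)"
  unfolding test_approximable_def
proof (intro allI impI)
  fix e :: real assume e: "e > 0"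
  \<comment> \<open>Adding 1 avoids a separate case for \<open>c = 0\<close>.\<close>
  have "e / (c\<^sup>2 + 1) > 0" using e by (simp add: add_nonneg_pos)
  then obtain \<phi> where \<phi>: "test_function \<phi>" "(LINT x|lebesgue. (f x - \<phi> x)\<^sup>2) < e / (c\<^sup>2 + 1)"
    using f(2) unfolding test_approximable_def by meson
  have "(LINT x|lebesgue. (c * f x - c * \<phi> x)\<^sup>2) = c\<^sup>2 * (LINT x|lebesgue. (f x - \<phi> x)\<^sup>2)"
    by (simp add: power_mult_distrib flip: right_diff_distrib)
  also have "\<dots> \<le> (c\<^sup>2 + 1) * (LINT x|lebesgue. (f x - \<phi> x)\<^sup>2)"
    by (intro mult_right_mono) auto
  also have "\<dots> < e"
    using \<phi>(2) by (simp add: pos_less_divide_eq add_nonneg_pos mult.commute)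
  finally show "\<exists>\<phi>. test_function \<phi> \<and> (LINT x|lebesgue. (c * f x - \<phi> x)\<^sup>2) < e"
    using test_function_cmult[OF \<phi>(1)] by blast
qed

lemma L2_indicator_Int_box:
  assumes "A \<in> sets lebesgue"
  shows "(indicator (A \<inter> box a c) :: _ \<Rightarrow> real) \<in> L2_space UNIV"
proof (rule L2_indicator)
  have "emeasure lebesgue (A \<inter> box a c) \<le> emeasure lebesgue (box a c)"
    by (rule emeasure_mono) auto
  also have "\<dots> < \<infinity>" using emeasure_bounded_finite[OF bounded_box] by simp
  finally show "emeasure lebesgue (A \<inter> box a c) < \<infinity>" .
qed (use assms in auto)

lemma test_approximable_box: "test_approximable (indicator (box a c))"
proof (rule test_approximable_dominated)
  show L2: "(indicator (box a c) :: _ \<Rightarrow> real) \<in> L2_space UNIV" "(indicator (box a c) :: _ \<Rightarrow> real) \<in> L2_space UNIV"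
    using L2_indicator_Int_box[of UNIV a c] by auto
  show "AE x in lebesgue. \<bar>box_bump n a c x\<bar> \<le> \<bar>indicator (box a c) x\<bar>" for n
    using box_bump_outside[of _ a c n] box_bump_bounds[of n a c] by (auto simp: indicator_def)
  show "AE x in lebesgue. (\<lambda>n. box_bump n a c x) \<longlonglongrightarrow> indicator (box a c) x"
    by (simp add: box_bump_LIMSEQ)
qed (auto intro: test_function_L2 test_approximable_test_function test_function_box_bump)

text \<open>Dynkin's \<pi>-\<lambda> theorem: open boxes are closed under intersection and generate
  the Borel sets.\<close>

lemma borel_induct_box [consumes 1, case_names basic empty compl union]:
  fixes A :: "'a::euclidean_space set"
  assumes "A \<in> sets borel"
    and "\<And>a c. P (box a c)" "P {}"
    and "\<And>A. A \<in> sets borel \<Longrightarrow> P A \<Longrightarrow> P (- A)"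
    and "\<And>A. disjoint_family A \<Longrightarrow> (\<And>i. A i \<in> sets borel) \<Longrightarrow> (\<And>i. P (A i)) \<Longrightarrow> P (\<Union>i::nat. A i)"
  shows "P A"
proof -
  let ?G = "range (\<lambda>(a, b). box a b) :: 'a set set"
  have borel: "sigma_sets UNIV ?G = sets borel"
    by (simp add: borel_eq_box)
  have "Int_stable ?G" by (auto simp: Int_stable_def box_Int_box)
  moreover have "?G \<subseteq> Pow UNIV" by simp
  moreover have "A \<in> sigma_sets UNIV ?G" using assms(1) borel by simp
  ultimately show ?thesis
    by (rule sigma_sets_induct_disjoint)
       (use assms in \<open>auto simp: borel Compl_eq_Diff_UNIV image_subset_iff\<close>)
qed

text \<open>By disjointness a partial sum is again an indicator, that of a finite union; both claims
  are read off from this.\<close>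

lemma sums_indicator_disjoint:
  assumes "disjoint_family A"
  shows "(\<lambda>n. \<Sum>i<n. indicator (A i \<inter> B) x) \<longlonglongrightarrow> (indicator ((\<Union>i. A i) \<inter> B) x :: real)"
    and "(\<Sum>i<n. indicator (A i \<inter> B) x) \<le> (indicator B x :: real)"
proof -
  have eq: "(\<Sum>i<n. indicator (A i \<inter> B) x) = (indicator ((\<Union>i<n. A i) \<inter> B) x :: real)" for n
  proof -
    have "disjoint_family_on (\<lambda>i. A i \<inter> B) {..<n}"
      using assms by (auto simp: disjoint_family_on_def)
    from indicator_UN_disjoint[OF _ this, of x]
    have "(indicator (\<Union>i<n. A i \<inter> B) x :: real) = (\<Sum>i<n. indicator (A i \<inter> B) x)"
      by blast
    moreover have "(\<Union>i<n. A i \<inter> B) = (\<Union>i<n. A i) \<inter> B" by blast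
    ultimately show ?thesis by metis
  qed
  show "(\<Sum>i<n. indicator (A i \<inter> B) x) \<le> (indicator B x :: real)"
    unfolding eq by (simp add: indicator_def)
  show "(\<lambda>n. \<Sum>i<n. indicator (A i \<inter> B) x) \<longlonglongrightarrow> (indicator ((\<Union>i. A i) \<inter> B) x :: real)"
    unfolding eq using LIMSEQ_indicator_UN[of "\<lambda>i. A i \<inter> B" x] by simp
qed

text \<open>Cutting with a fixed box keeps all measures finite. This makes complements harmless and
  gives countable unions the indicator of the box as a common dominating function.\<close>

lemma test_approximable_borel_Int_box:
  fixes a c :: "'a::euclidean_space"
  assumes "A \<in> sets borel"
  shows "test_approximable (indicator (A \<inter> box a c))"
  using assms
proof (induction A rule: borel_induct_box)
  case (basic a' c')
  then show ?case
    by (simp add: box_Int_box test_approximable_box)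
next
  case empty
  then show ?case
    using test_approximable_test_function[OF test_function_0] by (simp add: indicator_def)
next
  case (compl A)
  have "test_approximable (\<lambda>x. indicator (box a c) x + (-1) * indicator (A \<inter> box a c) x)"
    using compl L2_indicator_Int_box[of UNIV a c] L2_indicator_Int_box[of A a c]
    by (intro test_approximable_add test_approximable_cmult L2_cmult test_approximable_box) auto
  moreover have "(\<lambda>x. indicator (box a c) x + (-1) * indicator (A \<inter> box a c) x) = (indicator (- A \<inter> box a c) :: _ \<Rightarrow> real)"
    by (auto simp: indicator_def)
  ultimately show ?case by simp
next
  case (union A)
  have L2: "(\<lambda>x. \<Sum>i<n. indicator (A i \<inter> box a c) x :: real) \<in> L2_space UNIV
       \<and> test_approximable (\<lambda>x. \<Sum>i<n. indicator (A i \<inter> box a c) x)" for n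
  proof (induction n)
    case 0
    then show ?case
      using test_function_0 by (auto intro: test_approximable_test_function test_function_L2)
  next
    case (Suc n)
    then show ?case
      using union L2_indicator_Int_box[of "A n" a c]
      by (auto intro!: L2_add test_approximable_add)
  qed
  show ?case
  proof (rule test_approximable_dominated)
    show "(indicator ((\<Union>i. A i) \<inter> box a c) :: _ \<Rightarrow> real) \<in> L2_space UNIV"
      using union by (intro L2_indicator_Int_box) (auto simp: sets_completionI_sets)
    show "(indicator (UNIV \<inter> box a c) :: _ \<Rightarrow> real) \<in> L2_space UNIV"
      by (intro L2_indicator_Int_box) auto
    show "AE x in lebesgue. \<bar>\<Sum>i<n. indicator (A i \<inter> box a c) x\<bar> \<le> \<bar>indicator (UNIV \<inter> box a c) x :: real\<bar>" for n
      using sums_indicator_disjoint(2)[OF union(1)] by (simp add: sum_nonneg)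
    show "AE x in lebesgue. (\<lambda>n. \<Sum>i<n. indicator (A i \<inter> box a c) x) \<longlonglongrightarrow> (indicator ((\<Union>i. A i) \<inter> box a c) x :: real)"
      using sums_indicator_disjoint(1)[OF union(1)] by simp
  qed (use L2 in auto)
qed

lemma LIMSEQ_indicator_boxes:
  "(\<lambda>n. indicator (A \<inter> box (- (real n *\<^sub>R One)) (real n *\<^sub>R One)) x) \<longlonglongrightarrow> (indicator A x :: real)"
proof -
  obtain n0 where n0: "norm x < real n0" using reals_Archimedean2 by blast
  have "x \<in> box (- (real n *\<^sub>R One)) (real n *\<^sub>R One)" if "n \<ge> n0" for n
  proof -
    have "\<bar>x \<bullet> b\<bar> < n" if "b \<in> Basis" for b
      using Basis_le_norm[OF that, of x] n0 \<open>n \<ge> n0\<close> by linarith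
    then show ?thesis by (force simp: mem_box)
  qed
  then have "\<forall>\<^sub>F n in sequentially. indicator (A \<inter> box (- (real n *\<^sub>R One)) (real n *\<^sub>R One)) x = (indicator A x :: real)"
    by (auto simp: eventually_sequentially indicator_def intro!: exI[of _ n0])
  then show ?thesis by (rule tendsto_eventually)
qed

text \<open>The indicator of \<open>A\<close> agrees almost everywhere with a Borel function; its
  level set at 1 serves as \<open>B\<close>.\<close>

lemma lebesgue_set_AE_borel:
  fixes A :: "'a::euclidean_space set"
  assumes "A \<in> sets lebesgue"
  obtains B where "B \<in> sets borel" "AE x in lebesgue. x \<in> A \<longleftrightarrow> x \<in> B"
proof -
  obtain g where g: "g \<in> borel_measurable lborel" "AE x in lborel. indicator A x = (g x :: real)"
    using completion_ex_borel_measurable_real[of "indicator A" lborel] assms by auto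
  have "g -` {1} \<in> sets borel"
    using g(1) by (auto intro!: measurable_sets_borel)
  moreover have "AE x in lebesgue. x \<in> A \<longleftrightarrow> x \<in> g -` {1}"
    using AE_completion[OF g(2)] by eventually_elim (auto split: split_indicator_asm)
  ultimately show ?thesis using that by blast
qed

lemma test_approximable_indicator:
  fixes A :: "'a::euclidean_space set"
  assumes A: "A \<in> sets lebesgue" and ind: "(indicator A :: _ \<Rightarrow> real) \<in> L2_space UNIV"
  shows "test_approximable (indicator A)"
proof -
  obtain B where B: "B \<in> sets borel" and AB: "AE x in lebesgue. x \<in> A \<longleftrightarrow> x \<in> B"
    using lebesgue_set_AE_borel[OF A] by blast
  show ?thesis
  proof (rule test_approximable_dominated[OF ind ind])
    fix n :: nat
    let ?U = "box (- (real n *\<^sub>R One)) (real n *\<^sub>R One) :: 'a set"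
    show "(indicator (B \<inter> ?U) :: _ \<Rightarrow> real) \<in> L2_space UNIV"
      using B by (intro L2_indicator_Int_box) auto
    show "test_approximable (indicator (B \<inter> ?U))"
      using B by (rule test_approximable_borel_Int_box)
    show "AE x in lebesgue. \<bar>indicator (B \<inter> ?U) x\<bar> \<le> \<bar>indicator A x :: real\<bar>"
      using AB by eventually_elim (auto simp: indicator_def split: if_splits)
  next
    show "AE x in lebesgue. (\<lambda>n. indicator (B \<inter> box (- (real n *\<^sub>R One)) (real n *\<^sub>R One)) x) \<longlonglongrightarrow> (indicator A x :: real)"
      using AB
    proof eventually_elim
      case (elim x)
      then have "indicator A x = (indicator B x :: real)" by (simp add: indicator_def)
      then show ?case using LIMSEQ_indicator_boxes[of B x] by simp
    qed
  qed
qed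

lemma test_approximable_nonneg:
  fixes f :: "'a::euclidean_space \<Rightarrow> real"
  assumes "f \<in> L2_space UNIV" "\<And>x. 0 \<le> f x"
  shows "test_approximable f"
proof -
  have "f \<in> borel_measurable lebesgue" using assms(1) by (rule L2_measurable)
  \<comment> \<open>The induction rule passes through arbitrary nonnegative measurable functions, so
    square integrability travels inside the formula; nonnegative summands and lower members of a
    monotone sequence inherit it by domination.\<close>
  then have "f \<in> L2_space UNIV \<longrightarrow> test_approximable f"
    using assms(2)
  proof (induction f rule: borel_measurable_induct_real)
    case (set A)
    then show ?case by (simp add: test_approximable_indicator)
  next
    case (mult u c)
    show ?case
    \<comment> \<open>For \<open>c = 0\<close> the product is in L2 whatever \<open>u\<close> is, so
      nothing can be inferred about \<open>u\<close>.\<close>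
    proof (cases "c = 0")
      case True
      then show ?thesis using test_approximable_test_function[OF test_function_0] by (intro impI) (simp only: mult_zero_left)
    next
      case False
      show ?thesis
      proof
        assume "(\<lambda>x. c * u x) \<in> L2_space UNIV"
        from L2_cmult[OF this, of "1/c"] have "u \<in> L2_space UNIV" using False by simp
        with mult show "test_approximable (\<lambda>x. c * u x)" by (simp add: test_approximable_cmult)
      qed
    qed
  next
    case (add u v)
    show ?case
    proof
      assume *: "(\<lambda>x. v x + u x) \<in> L2_space UNIV"
      have "u \<in> L2_space UNIV"
        by (rule L2_dominated[OF *, where C = 1]) (use add in auto)
      moreover have "v \<in> L2_space UNIV"
        by (rule L2_dominated[OF *, where C = 1]) (use add in auto)
      ultimately show "test_approximable (\<lambda>x. v x + u x)"
        using add by (simp add: test_approximable_add)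
    qed
  next
    case (seq U)
    show ?case
    proof
      assume *: "f \<in> L2_space UNIV"
      have le: "U n x \<le> f x" for n x
        using seq by (intro incseq_le) (auto simp: incseq_def le_fun_def)
      then have L2: "U n \<in> L2_space UNIV" for n
        by (intro L2_dominated[OF *, where C = 1]) (use seq in \<open>auto intro!: AE_I2 order_trans[OF _ abs_ge_self]\<close>)
      show "test_approximable f"
        by (rule test_approximable_dominated[OF * * L2])
           (use seq L2 le in \<open>auto intro!: AE_I2 order_trans[OF _ abs_ge_self]\<close>)
    qed
  qed
  with assms show ?thesis by blast
qed

theorem L2_test_approximable:
  fixes f :: "'a::euclidean_space \<Rightarrow> real"
  assumes f: "f \<in> L2_space UNIV"
  shows "test_approximable f"
proof -
  have [measurable]: "f \<in> borel_measurable lebesgue" using f by (rule L2_measurable)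
  have L2: "(\<lambda>x. max 0 (f x)) \<in> L2_space UNIV" "(\<lambda>x. max 0 (- f x)) \<in> L2_space UNIV"
    by (intro L2_dominated[OF f, where C = 1]; auto)+
  have "test_approximable (\<lambda>x. max 0 (f x) + (-1) * max 0 (- f x))"
    using L2 by (intro test_approximable_add test_approximable_cmult L2_cmult test_approximable_nonneg) auto
  moreover have "max 0 (f x) + (-1) * max 0 (- f x) = f x" for x by auto
  ultimately show ?thesis by simp
qed

section \<open>Locally integrable functions tested against test functions\<close>

lemma integral_Cauchy_Schwarz:
  fixes f g :: "'a::euclidean_space \<Rightarrow> real"
  assumes f: "f \<in> L2_space UNIV" and g: "g \<in> L2_space UNIV"
  shows "(LINT x|lebesgue. f x * g x)\<^sup>2 \<le> (LINT x|lebesgue. (f x)\<^sup>2) * (LINT x|lebesgue. (g x)\<^sup>2)"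
proof -
  define a b c where "a = (LINT x|lebesgue. (f x)\<^sup>2)" and "b = (LINT x|lebesgue. (g x)\<^sup>2)"
    and "c = (LINT x|lebesgue. f x * g x)"
  have int: "integrable lebesgue (\<lambda>x. (f x)\<^sup>2)" "integrable lebesgue (\<lambda>x. (g x)\<^sup>2)" "integrable lebesgue (\<lambda>x. f x * g x)"
    using assms by (auto intro: L2_square_integrable L2_mult_integrable)
  have b: "b \<ge> 0" by (simp add: b_def)
  \<comment> \<open>Up to scaling, b f - c g is the component of f orthogonal to g; expanding its
    squared norm leaves b (a b - c^2).\<close>
  have "0 \<le> (LINT x|lebesgue. (b * f x - c * g x)\<^sup>2)" by simp
  also have "\<dots> = (LINT x|lebesgue. b\<^sup>2 * (f x)\<^sup>2 - 2 * b * c * (f x * g x) + c\<^sup>2 * (g x)\<^sup>2)"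
    by (intro Bochner_Integration.integral_cong refl) (simp add: power2_diff power_mult_distrib algebra_simps)
  also have "\<dots> = b\<^sup>2 * a - 2 * b * c * c + c\<^sup>2 * b"
    using int by (simp add: a_def b_def c_def)
  finally have *: "0 \<le> b * (a * b - c\<^sup>2)"
    by (simp add: algebra_simps power2_eq_square)
  have "c\<^sup>2 \<le> a * b"
  proof (cases "b = 0")
    case True
    then have "AE x in lebesgue. (g x)\<^sup>2 = 0"
      using integral_nonneg_eq_0_iff_AE[OF int(2)] by (simp add: b_def)
    then have "AE x in lebesgue. f x * g x = 0" by eventually_elim simp
    then have "c = 0" unfolding c_def by (rule integral_eq_zero_AE)
    with True show ?thesis by simp
  next
    case False
    with * b show ?thesis by (simp add: zero_le_mult_iff)
  qed
  then show ?thesis by (simp add: a_def b_def c_def)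
qed

lemma L2_tendsto_integral:
  fixes f g :: "'a::euclidean_space \<Rightarrow> real"
  assumes f: "f \<in> L2_space UNIV" and g: "g \<in> L2_space UNIV" "\<And>n. g' n \<in> L2_space UNIV"
    and lim: "(\<lambda>n. LINT x|lebesgue. (g x - g' n x)\<^sup>2) \<longlonglongrightarrow> 0"
  shows "(\<lambda>n. LINT x|lebesgue. f x * g' n x) \<longlonglongrightarrow> (LINT x|lebesgue. f x * g x)"
proof -
  have "(\<lambda>n. sqrt ((LINT x|lebesgue. (f x)\<^sup>2) * (LINT x|lebesgue. (g x - g' n x)\<^sup>2))) \<longlonglongrightarrow> sqrt ((LINT x|lebesgue. (f x)\<^sup>2) * 0)"
    using lim by (intro tendsto_intros)
  then have lim': "(\<lambda>n. sqrt ((LINT x|lebesgue. (f x)\<^sup>2) * (LINT x|lebesgue. (g x - g' n x)\<^sup>2))) \<longlonglongrightarrow> 0" by simp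
  have "\<bar>(LINT x|lebesgue. f x * g' n x) - (LINT x|lebesgue. f x * g x)\<bar>
      \<le> sqrt ((LINT x|lebesgue. (f x)\<^sup>2) * (LINT x|lebesgue. (g x - g' n x)\<^sup>2))" for n
  proof -
    have "(LINT x|lebesgue. f x * g x) - (LINT x|lebesgue. f x * g' n x) = (LINT x|lebesgue. f x * (g x - g' n x))"
      using L2_mult_integrable[OF f g(1)] L2_mult_integrable[OF f g(2)] by (simp add: right_diff_distrib)
    then show ?thesis
      using real_sqrt_le_mono[OF integral_Cauchy_Schwarz[OF f L2_diff[OF g(1) g(2)[of n]]]]
      by (simp add: abs_minus_commute)
  qed
  then have "\<forall>n. norm ((LINT x|lebesgue. f x * g' n x) - (LINT x|lebesgue. f x * g x))
      \<le> sqrt ((LINT x|lebesgue. (f x)\<^sup>2) * (LINT x|lebesgue. (g x - g' n x)\<^sup>2))" by simp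
  then show ?thesis
    using Lim_null_comparison[OF always_eventually lim'] Lim_null by fast
qed

text \<open>Expanding the square of g - g' n reduces convergence of the norms to that of the pairing
  with the fixed function g.\<close>

lemma L2_tendsto_norm:
  fixes g :: "'a::euclidean_space \<Rightarrow> real"
  assumes g: "g \<in> L2_space UNIV" "\<And>n. g' n \<in> L2_space UNIV"
    and lim: "(\<lambda>n. LINT x|lebesgue. (g x - g' n x)\<^sup>2) \<longlonglongrightarrow> 0"
  shows "(\<lambda>n. LINT x|lebesgue. (g' n x)\<^sup>2) \<longlonglongrightarrow> (LINT x|lebesgue. (g x)\<^sup>2)"
proof -
  have "(LINT x|lebesgue. (g x - g' n x)\<^sup>2) + 2 * (LINT x|lebesgue. g x * g' n x) - (LINT x|lebesgue. (g x)\<^sup>2)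
      = (LINT x|lebesgue. (g' n x)\<^sup>2)" for n
  proof -
    have "(LINT x|lebesgue. (g x - g' n x)\<^sup>2) = (LINT x|lebesgue. (g x)\<^sup>2 + (g' n x)\<^sup>2 - 2 * (g x * g' n x))"
      by (simp add: power2_diff mult.assoc)
    also have "\<dots> = (LINT x|lebesgue. (g x)\<^sup>2) + (LINT x|lebesgue. (g' n x)\<^sup>2) - 2 * (LINT x|lebesgue. g x * g' n x)"
      using L2_square_integrable[OF g(1)] L2_square_integrable[OF g(2)[of n]] L2_mult_integrable[OF g(1) g(2)[of n]]
      by simp
    finally show ?thesis by simp
  qed
  moreover have "(\<lambda>n. (LINT x|lebesgue. (g x - g' n x)\<^sup>2) + 2 * (LINT x|lebesgue. g x * g' n x) - (LINT x|lebesgue. (g x)\<^sup>2))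
     \<longlonglongrightarrow> 0 + 2 * (LINT x|lebesgue. g x * g x) - (LINT x|lebesgue. (g x)\<^sup>2)"
    by (intro tendsto_intros lim L2_tendsto_integral assms)
  ultimately show ?thesis by (simp add: power2_eq_square)
qed

lemma L2_test_sequence:
  fixes f :: "'a::euclidean_space \<Rightarrow> real"
  assumes "f \<in> L2_space UNIV"
  obtains \<phi> where "\<And>n. test_function (\<phi> n)" "(\<lambda>n. LINT x|lebesgue. (f x - \<phi> n x)\<^sup>2) \<longlonglongrightarrow> 0"
proof -
  have "\<forall>n. \<exists>\<phi>. test_function \<phi> \<and> (LINT x|lebesgue. (f x - \<phi> x)\<^sup>2) < 1 / real (Suc n)"
    using L2_test_approximable[OF assms] by (simp add: test_approximable_def)
  then obtain \<phi> where \<phi>: "\<And>n. test_function (\<phi> n)" "\<And>n. (LINT x|lebesgue. (f x - \<phi> n x)\<^sup>2) < 1 / real (Suc n)"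
    by metis
  have "(\<lambda>n. LINT x|lebesgue. (f x - \<phi> n x)\<^sup>2) \<longlonglongrightarrow> 0"
  proof (rule tendsto_sandwich)
    show "\<forall>\<^sub>F n in sequentially. 0 \<le> (LINT x|lebesgue. (f x - \<phi> n x)\<^sup>2)" by simp
    show "\<forall>\<^sub>F n in sequentially. (LINT x|lebesgue. (f x - \<phi> n x)\<^sup>2) \<le> inverse (real (Suc n))"
      using \<phi>(2) by (auto simp: inverse_eq_divide less_imp_le)
  qed (simp, rule LIMSEQ_inverse_real_of_nat)
  with \<phi>(1) that show ?thesis by blast
qed

lemma locally_integrable_mult:
  fixes w \<phi> :: "'a::euclidean_space \<Rightarrow> real"
  assumes w: "locally_integrable w" and [measurable]: "\<phi> \<in> borel_measurable lebesgue"
    and B: "\<And>x. \<bar>\<phi> x\<bar> \<le> B" and r: "\<And>x. norm x \<ge> r \<Longrightarrow> \<phi> x = 0"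
  shows "integrable lebesgue (\<lambda>x. w x * \<phi> x)"
proof -
  have int: "integrable lebesgue (\<lambda>x. indicator (cball 0 r) x * w x)"
    using w by (simp add: locally_integrable_def set_integrable_def)
  then have "integrable lebesgue (\<lambda>x. (indicator (cball 0 r) x * w x) * \<phi> x)"
    by (intro Bochner_Integration.integrable_bound[OF integrable_mult_right[OF integrable_norm[OF int], of B]])
       (auto intro!: AE_I2 mult_right_mono order_trans[OF B abs_ge_self] simp: abs_mult mult.commute[of _ "\<bar>\<phi> _\<bar>"])
  moreover have "(indicator (cball 0 r) x * w x) * \<phi> x = w x * \<phi> x" for x
    using r[of x] by (cases "norm x \<le> r") auto
  ultimately show ?thesis by simp
qed

lemma locally_integrable_mult_test:
  fixes w :: "'a::euclidean_space \<Rightarrow> real"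
  assumes "locally_integrable w" "test_function \<phi>"
  shows "integrable lebesgue (\<lambda>x. w x * \<phi> x)"
proof -
  obtain r B where "\<And>x. norm x \<ge> r \<Longrightarrow> \<phi> x = 0" "\<And>x. \<bar>\<phi> x\<bar> \<le> B"
    using test_function_support[OF assms(2)] test_function_bounded[OF assms(2)] by metis
  then show ?thesis
    using assms by (intro locally_integrable_mult test_function_measurable)
qed

text \<open>The fundamental lemma of the calculus of variations. The bumps of a box are dominated by
  its indicator, so \<open>g\<close> integrates to 0 over boxes; \<pi>-\<lambda> induction extends
  this to Borel subsets of a box, and a function with vanishing integral over every measurable set
  is 0 almost everywhere.\<close>

theorem locally_integrable_zero_if_test_zero:
  fixes g :: "'a::euclidean_space \<Rightarrow> real"
  assumes g: "locally_integrable g"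
    and zero: "\<And>\<phi>. test_function \<phi> \<Longrightarrow> (LINT x|lebesgue. g x * \<phi> x) = 0"
  shows "AE x in lebesgue. g x = 0"
proof -
  have int: "integrable lebesgue (\<lambda>x. g x * indicator (A \<inter> box a c) x)" if "A \<in> sets lebesgue" for A a c
  proof -
    obtain r where r: "box a c \<subseteq> ball 0 r"
      using bounded_box bounded_subset_ballD by blast
    show ?thesis
      by (rule locally_integrable_mult[OF g, where B = 1 and r = r])
         (use that r in \<open>auto simp: subset_iff split: split_indicator intro!: borel_measurable_indicator\<close>)
  qed
  have box: "(LINT x|lebesgue. g x * indicator (box a c) x) = 0" for a c
  proof -
    have "(\<lambda>n. LINT x|lebesgue. g x * box_bump n a c x) \<longlonglongrightarrow> (LINT x|lebesgue. g x * indicator (box a c) x)"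
    proof (rule integral_dominated_convergence)
      show i: "integrable lebesgue (\<lambda>x. \<bar>g x * indicator (box a c) x\<bar>)"
        using int[of UNIV a c] by simp
      show "(\<lambda>x. g x * indicator (box a c) x) \<in> borel_measurable lebesgue"
        using int[of UNIV a c] by (simp add: borel_measurable_integrable)
      show "(\<lambda>x. g x * box_bump n a c x) \<in> borel_measurable lebesgue" for n
        using locally_integrable_mult_test[OF g test_function_box_bump] by (rule borel_measurable_integrable)
      show "AE x in lebesgue. (\<lambda>n. g x * box_bump n a c x) \<longlonglongrightarrow> g x * indicator (box a c) x"
        by (auto intro!: AE_I2 tendsto_mult box_bump_LIMSEQ)
      have "\<bar>g x * box_bump n a c x\<bar> \<le> \<bar>g x * indicator (box a c) x\<bar>" for n x
        using box_bump_outside[of x a c n] box_bump_bounds[of n a c x]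
        by (cases "x \<in> box a c") (auto simp: abs_mult intro: mult_left_le)
      then show "AE x in lebesgue. norm (g x * box_bump n a c x) \<le> \<bar>g x * indicator (box a c) x\<bar>" for n
        by simp
    qed
    then show ?thesis
      using zero[OF test_function_box_bump] by (simp add: LIMSEQ_const_iff)
  qed
  have borel: "(LINT x|lebesgue. g x * indicator (A \<inter> box a c) x) = 0" if "A \<in> sets borel" for A a c
    using that
  proof (induction A rule: borel_induct_box)
    case (basic a' c')
    then show ?case by (simp add: box_Int_box box)
  next
    case (compl A)
    have "(LINT x|lebesgue. g x * indicator (- A \<inter> box a c) x)
        = (LINT x|lebesgue. g x * indicator (UNIV \<inter> box a c) x - g x * indicator (A \<inter> box a c) x)"
      by (intro Bochner_Integration.integral_cong) (auto simp: indicator_def)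
    also have "\<dots> = (LINT x|lebesgue. g x * indicator (UNIV \<inter> box a c) x) - (LINT x|lebesgue. g x * indicator (A \<inter> box a c) x)"
      using compl by (intro Bochner_Integration.integral_diff int) auto
    finally show ?case using compl box by simp
  next
    case (union A)
    have A: "A i \<in> sets lebesgue" for i using union(2) by simp
    have "(\<lambda>n. LINT x|lebesgue. (\<Sum>i<n. g x * indicator (A i \<inter> box a c) x))
        \<longlonglongrightarrow> (LINT x|lebesgue. g x * indicator ((\<Union>i. A i) \<inter> box a c) x)"
    proof (rule integral_dominated_convergence)
      show "integrable lebesgue (\<lambda>x. \<bar>g x * indicator (UNIV \<inter> box a c) x\<bar>)"
        using int[of UNIV a c] by simp
      show "(\<lambda>x. g x * indicator ((\<Union>i. A i) \<inter> box a c) x) \<in> borel_measurable lebesgue"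
        using A by (intro borel_measurable_integrable int) auto
      show "(\<lambda>x. \<Sum>i<n. g x * indicator (A i \<inter> box a c) x) \<in> borel_measurable lebesgue" for n
        using A by (intro borel_measurable_sum borel_measurable_integrable int) auto
      show "AE x in lebesgue. (\<lambda>n. \<Sum>i<n. g x * indicator (A i \<inter> box a c) x) \<longlonglongrightarrow> g x * indicator ((\<Union>i. A i) \<inter> box a c) x"
        unfolding sum_distrib_left[symmetric]
        by (intro AE_I2 tendsto_mult tendsto_const sums_indicator_disjoint union)
      have "\<bar>g x * (\<Sum>i<n. indicator (A i \<inter> box a c) x)\<bar> \<le> \<bar>g x * indicator (UNIV \<inter> box a c) x\<bar>" for n x
        using sums_indicator_disjoint(2)[OF union(1), where n = n and B = "box a c" and x = x]
        unfolding abs_mult by (intro mult_left_mono) (auto simp: sum_nonneg)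
      then show "AE x in lebesgue. norm (\<Sum>i<n. g x * indicator (A i \<inter> box a c) x) \<le> \<bar>g x * indicator (UNIV \<inter> box a c) x\<bar>" for n
        by (simp add: sum_distrib_left)
    qed
    moreover have "(LINT x|lebesgue. (\<Sum>i<n. g x * indicator (A i \<inter> box a c) x)) = 0" for n
      using union(3) int[OF A] by (subst Bochner_Integration.integral_sum) auto
    ultimately show ?case by (simp add: LIMSEQ_const_iff)
  qed simp
  have "AE x in lebesgue. g x * indicator (box a c) x = 0" for a c
  proof (rule density_unique_real)
    show "integrable lebesgue (\<lambda>x. g x * indicator (box a c) x)"
      using int[of UNIV a c] by simp
    fix A :: "'a set" assume A: "A \<in> sets lebesgue"
    obtain B where B: "B \<in> sets borel" "AE x in lebesgue. x \<in> A \<longleftrightarrow> x \<in> B"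
      using lebesgue_set_AE_borel[OF A] by blast
    \<comment> \<open>Passing to the Borel set \<open>B\<close> changes the integrand only on a null
      set and makes the Borel case applicable.\<close>
    have "(LINT x:A|lebesgue. g x * indicator (box a c) x) = (LINT x|lebesgue. g x * indicator (B \<inter> box a c) x)"
      unfolding set_lebesgue_integral_def
    proof (rule integral_cong_AE)
      show "(\<lambda>x. indicat_real A x *\<^sub>R (g x * indicat_real (box a c) x)) \<in> borel_measurable lebesgue"
        using A int[of UNIV a c] by (intro borel_measurable_scaleR borel_measurable_indicator borel_measurable_integrable) auto
      show "(\<lambda>x. g x * indicator (B \<inter> box a c) x) \<in> borel_measurable lebesgue"
        using B(1) by (intro borel_measurable_integrable int) auto
      show "AE x in lebesgue. indicat_real A x *\<^sub>R (g x * indicat_real (box a c) x) = g x * indicator (B \<inter> box a c) x"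
        using B(2) by eventually_elim (auto simp: indicator_def)
    qed
    then show "(LINT x:A|lebesgue. g x * indicator (box a c) x) = (LINT x:A|lebesgue. 0)"
      using borel[OF B(1)] by (simp add: set_lebesgue_integral_def)
  qed simp
  then have "AE x in lebesgue. \<forall>n. g x * indicator (UNIV \<inter> box (- (real n *\<^sub>R One)) (real n *\<^sub>R One)) x = 0"
    by (simp only: AE_all_countable Int_UNIV_left simp_thms)
  then show ?thesis
  proof eventually_elim
    case (elim x)
    have "(\<lambda>n. g x * indicator (UNIV \<inter> box (- (real n *\<^sub>R One)) (real n *\<^sub>R One)) x) \<longlonglongrightarrow> g x * indicator UNIV x"
      by (intro tendsto_mult tendsto_const LIMSEQ_indicator_boxes)
    then have "(\<lambda>n::nat. 0) \<longlonglongrightarrow> g x * indicator UNIV x" by (simp only: elim)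
    then show ?case by (simp add: LIMSEQ_const_iff)
  qed
qed

section \<open>Differentiating the pairing with a translated test function\<close>

lemma test_function_DERIV:
  assumes "test_function \<phi>"
  shows "((\<lambda>t. \<phi> (x + t *\<^sub>R e)) has_real_derivative frechet_derivative \<phi> (at (x + t *\<^sub>R e)) e) (at t)"
proof -
  let ?D = "frechet_derivative \<phi> (at (x + t *\<^sub>R e))"
  have D: "(\<phi> has_derivative ?D) (at (x + t *\<^sub>R e))"
    by (rule test_function_frechet_derivative[OF assms])
  have "((\<lambda>t. x + t *\<^sub>R e) has_derivative (\<lambda>s. s *\<^sub>R e)) (at t)"
    by (auto intro!: derivative_eq_intros)
  from has_derivative_compose[OF this D]
  have "((\<lambda>t. \<phi> (x + t *\<^sub>R e)) has_derivative (\<lambda>s. ?D (s *\<^sub>R e))) (at t)" .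
  moreover have "?D (s *\<^sub>R e) = ?D e * s" for s
    using linear_cmul[OF has_derivative_linear[OF D]] by simp
  ultimately show ?thesis
    by (simp add: has_field_derivative_def)
qed

text \<open>Differentiation under the integral sign: by the mean value inequality the difference
  quotients of \<phi> share the bound \<open>B\<close>, and their supports lie in one ball, on which
  \<open>w\<close> is integrable.\<close>

lemma test_pairing_DERIV_0:
  fixes w :: "'a::euclidean_space \<Rightarrow> real"
  assumes w: "locally_integrable w" and \<phi>: "test_function \<phi>"
  shows "((\<lambda>t. LINT x|lebesgue. w x * \<phi> (x + t *\<^sub>R e)) has_real_derivative
    (LINT x|lebesgue. w x * frechet_derivative \<phi> (at x) e)) (at 0)"
proof -
  let ?F = "\<lambda>t. LINT x|lebesgue. w x * \<phi> (x + t *\<^sub>R e)"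
  let ?D = "\<lambda>x. frechet_derivative \<phi> (at x) e"
  obtain r where r: "\<And>x. norm x \<ge> r \<Longrightarrow> \<phi> x = 0" using test_function_support[OF \<phi>] by metis
  obtain B where B: "\<And>x. \<bar>?D x\<bar> \<le> B" using test_function_derivative_bounded[OF \<phi>] by metis
  have "((\<lambda>h. (?F h - ?F 0) / h) \<longlongrightarrow> (LINT x|lebesgue. w x * ?D x)) (at 0)"
    unfolding tendsto_at_iff_sequentially
  proof (intro allI impI, unfold comp_def)
    fix X :: "nat \<Rightarrow> real" assume X0: "\<forall>i. X i \<in> UNIV - {0}" and X: "X \<longlonglongrightarrow> 0"
    \<comment> \<open>Bounded step sizes confine the supports of all the quotients to the ball of
      radius \<open>r + c * norm e\<close>.\<close>
    obtain c where c: "\<And>n. \<bar>X n\<bar> \<le> c"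
      using convergent_imp_Bseq[OF convergentI[OF X]] by (auto simp: Bseq_def)
    define q where "q n x = (\<phi> (x + X n *\<^sub>R e) - \<phi> x) / X n" for n x
    have q_bound: "\<bar>q n x\<bar> \<le> B" for n x
    proof -
      have "norm (\<phi> (x + X n *\<^sub>R e) - \<phi> (x + 0 *\<^sub>R e)) \<le> B * norm (X n - 0)"
        by (rule field_differentiable_bound[where S = UNIV and f' = "\<lambda>t. ?D (x + t *\<^sub>R e)"])
           (use B test_function_DERIV[OF \<phi>] in auto)
      then show ?thesis using X0 by (simp add: q_def divide_le_eq)
    qed
    have q_support: "q n x = 0" if "norm x \<ge> r + c * norm e" for n x
    proof -
      have "norm (X n *\<^sub>R e) \<le> c * norm e" using c by (simp add: mult_right_mono)
      then have "norm (x + X n *\<^sub>R e) \<ge> r"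
        using that norm_triangle_ineq2[of x "- X n *\<^sub>R e"] by simp
      moreover have "0 \<le> c * norm e" using c[of 0] by simp
      then have "norm x \<ge> r" using that by linarith
      ultimately show ?thesis using r by (simp add: q_def)
    qed
    have q_meas: "q n \<in> borel_measurable lebesgue" for n
      unfolding q_def using test_function_measurable[OF \<phi>] test_function_measurable[OF test_function_shift[OF \<phi>]]
      by measurable
    have eq: "(?F (X n) - ?F 0) / X n = (LINT x|lebesgue. w x * q n x)" for n
    proof -
      have "(?F (X n) - ?F 0) / X n = (LINT x|lebesgue. (w x * \<phi> (x + X n *\<^sub>R e) - w x * \<phi> x) / X n)"
        using locally_integrable_mult_test[OF w test_function_shift[OF \<phi>]] locally_integrable_mult_test[OF w \<phi>]
        by simp
      then show ?thesis by (simp add: q_def right_diff_distrib)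
    qed
    have "(\<lambda>n. LINT x|lebesgue. w x * q n x) \<longlonglongrightarrow> (LINT x|lebesgue. w x * ?D x)"
    proof (rule integral_dominated_convergence)
      let ?R = "r + c * norm e"
      have "integrable lebesgue (\<lambda>x. indicator (cball 0 ?R) x * w x)"
        using w by (simp add: locally_integrable_def set_integrable_def)
      then show "integrable lebesgue (\<lambda>x. B * \<bar>indicator (cball 0 ?R) x * w x\<bar>)" by simp
      show "(\<lambda>x. w x * q n x) \<in> borel_measurable lebesgue" for n
        by (intro borel_measurable_integrable locally_integrable_mult[OF w q_meas q_bound q_support])
      \<comment> \<open>The derivative inherits the common support as the pointwise limit of the
        quotients.\<close>
      have D0: "?D x = 0" if "norm x \<ge> ?R" for x
      proof -
        have "(\<lambda>n. q n x) \<longlonglongrightarrow> ?D x" 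
          using test_function_DERIV[OF \<phi>, of x e 0] X0 X
          unfolding DERIV_def tendsto_at_iff_sequentially q_def comp_def by simp
        then show ?thesis using q_support[OF that] by (simp add: LIMSEQ_const_iff)
      qed
      show "(\<lambda>x. w x * ?D x) \<in> borel_measurable lebesgue"
        by (intro borel_measurable_integrable locally_integrable_mult[OF w test_function_derivative_measurable[OF \<phi>] B D0])
      show "AE x in lebesgue. (\<lambda>n. w x * q n x) \<longlonglongrightarrow> w x * ?D x"
        using test_function_DERIV[OF \<phi>, of _ e 0] X0 X
        unfolding DERIV_def tendsto_at_iff_sequentially q_def comp_def
        by (intro AE_I2 tendsto_mult tendsto_const) simp
      have "\<bar>w x * q n x\<bar> \<le> B * \<bar>indicator (cball 0 ?R) x * w x\<bar>" for n x
      proof (cases "norm x \<le> ?R")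
        case True
        then show ?thesis using q_bound[of n x] mult_left_mono[OF q_bound[of n x] abs_ge_zero[of "w x"]]
          by (simp add: abs_mult mult.commute)
      next
        case False
        then show ?thesis using q_support by simp
      qed
      then show "AE x in lebesgue. norm (w x * q n x) \<le> B * \<bar>indicator (cball 0 ?R) x * w x\<bar>" for n by simp
    qed
    then show "(\<lambda>n. (?F (X n) - ?F 0) / X n) \<longlonglongrightarrow> (LINT x|lebesgue. w x * ?D x)"
      by (simp only: eq)
  qed
  then show ?thesis by (simp add: DERIV_def)
qed

text \<open>The derivative at \<open>t\<close> for \<phi> is the derivative at 0 for the translate
  of \<phi> by \<open>t *\<^sub>R e\<close>. It is written with that translate so that the
  definition of a weak derivative can be applied to it directly.\<close>

lemma test_pairing_DERIV:
  fixes w :: "'a::euclidean_space \<Rightarrow> real"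
  assumes w: "locally_integrable w" and \<phi>: "test_function \<phi>"
  shows "((\<lambda>t. LINT x|lebesgue. w x * \<phi> (x + t *\<^sub>R e)) has_real_derivative
    (LINT x|lebesgue. w x * frechet_derivative (\<lambda>y. \<phi> (y + t *\<^sub>R e)) (at x) e)) (at t)"
  using test_pairing_DERIV_0[OF w test_function_shift[OF \<phi>, of "t *\<^sub>R e"], of e]
  by (simp add: DERIV_def algebra_simps)

section \<open>Weak derivatives and difference quotients\<close>

text \<open>A single direction is what a translation argument sees; integrability is strengthened
  from local to L2 so that weak L2 limits can be taken.\<close>

definition L2_weak_derivative :: "'a::euclidean_space \<Rightarrow> ('a \<Rightarrow> real) \<Rightarrow> ('a \<Rightarrow> real) \<Rightarrow> bool" where
  "L2_weak_derivative e u g \<longleftrightarrow> u \<in> L2_space UNIV \<and> g \<in> L2_space UNIV \<and>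
    (\<forall>\<phi>. test_function \<phi> \<longrightarrow>
      (LINT x|lebesgue. u x * frechet_derivative \<phi> (at x) e) = - (LINT x|lebesgue. g x * \<phi> x))"

lemma L2_weak_derivativeD:
  assumes "L2_weak_derivative e u g"
  shows "u \<in> L2_space UNIV" "g \<in> L2_space UNIV"
    and "test_function \<phi> \<Longrightarrow>
      (LINT x|lebesgue. u x * frechet_derivative \<phi> (at x) e) = - (LINT x|lebesgue. g x * \<phi> x)"
  using assms by (auto simp: L2_weak_derivative_def)

text \<open>A change of variables moves the translation onto \<phi>. The summand
  \<open>0 *\<^sub>R e\<close> is kept so that the right-hand side is the difference at -h and 0 of
  one function of t.\<close>

lemma increment_pairing:
  fixes w :: "'a::euclidean_space \<Rightarrow> real"
  assumes w: "w \<in> L2_space UNIV" and \<phi>: "test_function \<phi>"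
  shows "(LINT x|lebesgue. (w (x + h *\<^sub>R e) - w x) * \<phi> x)
    = (LINT x|lebesgue. w x * \<phi> (x + (- h) *\<^sub>R e)) - (LINT x|lebesgue. w x * \<phi> (x + 0 *\<^sub>R e))"
proof -
  have \<phi>2: "\<phi> \<in> L2_space UNIV" using \<phi> by (rule test_function_L2)
  have \<phi>h: "(\<lambda>x. \<phi> (x + (- h) *\<^sub>R e)) \<in> L2_space UNIV" using \<phi>2 by (rule L2_shift)
  have "(LINT x|lebesgue. w (x + h *\<^sub>R e) * \<phi> x) = (LINT x|lebesgue. w x * \<phi> (x + (- h) *\<^sub>R e))"
    using integral_lebesgue_shift[of "\<lambda>x. w x * \<phi> (x + (- h) *\<^sub>R e)" "h *\<^sub>R e"]
      L2_measurable[OF w] L2_measurable[OF \<phi>h] by simp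
  then show ?thesis
    using L2_mult_integrable[OF L2_shift[OF w] \<phi>2] L2_mult_integrable[OF w \<phi>2]
    by (simp add: left_diff_distrib)
qed

text \<open>No weak derivative of \<open>w\<close> is assumed, so this applies to a composition
  whose weak derivative is yet to be found.\<close>

lemma difference_quotient_pairing_tendsto:
  fixes w :: "'a::euclidean_space \<Rightarrow> real"
  assumes w: "w \<in> L2_space UNIV" and \<phi>: "test_function \<phi>"
  shows "((\<lambda>h. LINT x|lebesgue. (w (x + h *\<^sub>R e) - w x) / h * \<phi> x) \<longlongrightarrow>
    - (LINT x|lebesgue. w x * frechet_derivative \<phi> (at x) e)) (at 0)"
proof -
  let ?F = "\<lambda>t. LINT x|lebesgue. w x * \<phi> (x + t *\<^sub>R e)"
  have "((\<lambda>h. ?F (- h)) has_real_derivative - (LINT x|lebesgue. w x * frechet_derivative \<phi> (at x) e)) (at 0)"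
    using DERIV_mirror[THEN iffD1, of ?F _ "0::real"]
      test_pairing_DERIV_0[OF L2_locally_integrable[OF w] \<phi>, of e] by simp
  then show ?thesis
    using increment_pairing[OF w \<phi>, of _ e] by (simp add: DERIV_def)
qed

text \<open>Mean value inequality for t \<mapsto> \<integral> u \<phi>(x + t e), whose derivative is
  minus the pairing of g with the translated \<phi>. Young's inequality bounds that pairing by half
  the sum of the squared norms, uniformly in t.\<close>

lemma increment_test_bound:
  assumes ug: "L2_weak_derivative e u g" and \<phi>: "test_function \<phi>"
  shows "\<bar>LINT x|lebesgue. (u (x + h *\<^sub>R e) - u x) * \<phi> x\<bar>
    \<le> \<bar>h\<bar> * ((LINT x|lebesgue. (g x)\<^sup>2) + (LINT x|lebesgue. (\<phi> x)\<^sup>2)) / 2"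
proof -
  let ?F = "\<lambda>t. LINT x|lebesgue. u x * \<phi> (x + t *\<^sub>R e)"
  let ?M = "((LINT x|lebesgue. (g x)\<^sup>2) + (LINT x|lebesgue. (\<phi> x)\<^sup>2)) / 2"
  note u = L2_weak_derivativeD(1)[OF ug] and g = L2_weak_derivativeD(2)[OF ug]
  have bound: "\<bar>LINT x|lebesgue. g x * \<phi> (x + t *\<^sub>R e)\<bar> \<le> ?M" for t
  proof -
    let ?p = "\<lambda>x. \<phi> (x + t *\<^sub>R e)"
    have p: "?p \<in> L2_space UNIV" using \<phi> by (intro L2_shift test_function_L2)
    have "\<bar>LINT x|lebesgue. g x * ?p x\<bar> \<le> (LINT x|lebesgue. \<bar>g x * ?p x\<bar>)"
      by (rule integral_abs_bound)
    also have "\<dots> \<le> (LINT x|lebesgue. ((g x)\<^sup>2 + (?p x)\<^sup>2) / 2)"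
    proof (rule integral_mono)
      show "\<bar>g x * ?p x\<bar> \<le> ((g x)\<^sup>2 + (?p x)\<^sup>2) / 2" for x
        using sum_squares_bound[of "\<bar>g x\<bar>" "\<bar>?p x\<bar>"] by (simp add: abs_mult)
    qed (use g p in \<open>auto simp: L2_square_integrable L2_mult_integrable\<close>)
    also have "\<dots> = ((LINT x|lebesgue. (g x)\<^sup>2) + (LINT x|lebesgue. (?p x)\<^sup>2)) / 2"
      using g p by (simp add: L2_square_integrable)
    also have "(LINT x|lebesgue. (?p x)\<^sup>2) = (LINT x|lebesgue. (\<phi> x)\<^sup>2)"
      using integral_lebesgue_shift[of "\<lambda>x. (\<phi> x)\<^sup>2" "t *\<^sub>R e"] test_function_measurable[OF \<phi>] by simp
    finally show ?thesis .
  qed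
  have "norm (?F (- h) - ?F 0) \<le> ?M * norm (- h - 0)"
  proof (rule field_differentiable_bound[where S = UNIV and f' = "\<lambda>t. - (LINT x|lebesgue. g x * \<phi> (x + t *\<^sub>R e))"])
    show "(?F has_real_derivative - (LINT x|lebesgue. g x * \<phi> (x + t *\<^sub>R e))) (at t within UNIV)" for t
      using test_pairing_DERIV[OF L2_locally_integrable[OF u] \<phi>, of e t]
        L2_weak_derivativeD(3)[OF ug test_function_shift[OF \<phi>]] by simp
  qed (use bound in auto)
  then show ?thesis
    unfolding increment_pairing[OF u \<phi>] by (simp add: mult.commute)
qed

text \<open>Both sides are continuous in \<psi> for the L2 norm, so density of test functions
  applies. The extension allows testing with increments of \<open>u\<close> itself.\<close>

lemma increment_bound:
  assumes ug: "L2_weak_derivative e u g" and \<psi>: "\<psi> \<in> L2_space UNIV"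
  shows "\<bar>LINT x|lebesgue. (u (x + h *\<^sub>R e) - u x) * \<psi> x\<bar>
    \<le> \<bar>h\<bar> * ((LINT x|lebesgue. (g x)\<^sup>2) + (LINT x|lebesgue. (\<psi> x)\<^sup>2)) / 2"
proof -
  note u = L2_weak_derivativeD(1)[OF ug]
  obtain \<phi> where \<phi>: "\<And>n. test_function (\<phi> n)" "(\<lambda>n. LINT x|lebesgue. (\<psi> x - \<phi> n x)\<^sup>2) \<longlonglongrightarrow> 0"
    using L2_test_sequence[OF \<psi>] by blast
  note L2 = \<psi> test_function_L2[OF \<phi>(1)]
  have "(\<lambda>n. \<bar>LINT x|lebesgue. (u (x + h *\<^sub>R e) - u x) * \<phi> n x\<bar>) \<longlonglongrightarrow>
      \<bar>LINT x|lebesgue. (u (x + h *\<^sub>R e) - u x) * \<psi> x\<bar>"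
    by (intro tendsto_rabs L2_tendsto_integral L2_diff L2_shift u L2 \<phi>(2))
  moreover have "(\<lambda>n. \<bar>h\<bar> * ((LINT x|lebesgue. (g x)\<^sup>2) + (LINT x|lebesgue. (\<phi> n x)\<^sup>2)) / 2) \<longlonglongrightarrow>
      \<bar>h\<bar> * ((LINT x|lebesgue. (g x)\<^sup>2) + (LINT x|lebesgue. (\<psi> x)\<^sup>2)) / 2"
    by (intro tendsto_intros L2_tendsto_norm L2 \<phi>(2)) simp
  ultimately show ?thesis
    by (rule LIMSEQ_le) (use increment_test_bound[OF ug \<phi>(1)] in blast)
qed

text \<open>Testing with \<open>\<psi> = (u(\<cdot> + h e) - u) / \<bar>h\<bar>\<close> lets the last term of the previous bound be absorbed.\<close>

theorem increment_L2_bound: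
  assumes ug: "L2_weak_derivative e u g"
  shows "(LINT x|lebesgue. (u (x + h *\<^sub>R e) - u x)\<^sup>2) \<le> h\<^sup>2 * (LINT x|lebesgue. (g x)\<^sup>2)"
proof (cases "h = 0")
  case False
  note u = L2_weak_derivativeD(1)[OF ug]
  let ?d = "\<lambda>x. u (x + h *\<^sub>R e) - u x"
  define D where "D = (LINT x|lebesgue. (?d x)\<^sup>2)"
  define G where "G = (LINT x|lebesgue. (g x)\<^sup>2)"
  have d: "?d \<in> L2_space UNIV" by (intro L2_diff L2_shift u)
  have "\<bar>LINT x|lebesgue. ?d x * (1 / \<bar>h\<bar> * ?d x)\<bar>
      \<le> \<bar>h\<bar> * (G + (LINT x|lebesgue. (1 / \<bar>h\<bar> * ?d x)\<^sup>2)) / 2"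
    unfolding G_def by (rule increment_bound[OF ug L2_cmult[OF d]])
  moreover have "(LINT x|lebesgue. ?d x * (1 / \<bar>h\<bar> * ?d x)) = D / \<bar>h\<bar>"
    by (simp add: D_def power2_eq_square)
  moreover have "(LINT x|lebesgue. (1 / \<bar>h\<bar> * ?d x)\<^sup>2) = D / h\<^sup>2"
    by (simp add: D_def power_mult_distrib power_divide)
  moreover have "D \<ge> 0" by (simp add: D_def)
  ultimately have *: "D / \<bar>h\<bar> \<le> \<bar>h\<bar> * (G + D / \<bar>h\<bar>\<^sup>2) / 2"
    by (simp only: power2_abs abs_of_nonneg divide_nonneg_nonneg abs_ge_zero)
  have absorb: "D \<le> k\<^sup>2 * G" if "D / k \<le> k * (G + D / k\<^sup>2) / 2" "k > 0" for k
  proof -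
    define y where "y = D / k"
    have "k * (G + D / k\<^sup>2) = k * G + y"
      using \<open>k > 0\<close> by (simp add: y_def distrib_left power2_eq_square)
    with that(1) have "y \<le> k * G" by (simp add: y_def[symmetric])
    from mult_right_mono[OF this, of k] show ?thesis
      using \<open>k > 0\<close> by (simp add: y_def power2_eq_square mult_ac)
  qed
  have "D \<le> h\<^sup>2 * G" using absorb[OF *] False by simp
  then show ?thesis by (simp add: D_def G_def)
qed simp

lemma difference_quotient_L2:
  fixes u :: "'a::euclidean_space \<Rightarrow> real"
  assumes "u \<in> L2_space UNIV"
  shows "(\<lambda>x. (u (x + h *\<^sub>R e) - u x) / h) \<in> L2_space UNIV"
  using L2_cmult[OF L2_diff[OF L2_shift[OF assms] assms], of "1 / h"] by simp

lemma difference_quotient_L2_bound: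
  assumes "L2_weak_derivative e u g"
  shows "(LINT x|lebesgue. ((u (x + h *\<^sub>R e) - u x) / h)\<^sup>2) \<le> (LINT x|lebesgue. (g x)\<^sup>2)"
  using increment_L2_bound[OF assms, of h]
  by (cases "h = 0") (simp_all add: power_divide pos_divide_le_eq mult.commute)

text \<open>A family bounded in L2 converges weakly once it does so against a dense set: replacing
  \<psi> by a test function costs an error uniform in h.\<close>

theorem difference_quotient_weakly_tendsto:
  assumes ug: "L2_weak_derivative e u g" and \<psi>: "\<psi> \<in> L2_space UNIV"
  shows "((\<lambda>h. LINT x|lebesgue. (u (x + h *\<^sub>R e) - u x) / h * \<psi> x) \<longlongrightarrow> (LINT x|lebesgue. g x * \<psi> x)) (at 0)"
proof (rule tendstoI)
  fix \<epsilon> :: real assume \<epsilon>: "\<epsilon> > 0"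
  note u = L2_weak_derivativeD(1)[OF ug] and g = L2_weak_derivativeD(2)[OF ug]
  \<comment> \<open>Bounds the squared norm of the quotient minus \<open>g\<close>: each has squared
    norm at most that of \<open>g\<close>, and the sum inequality doubles both.\<close>
  define C where "C = 4 * (LINT x|lebesgue. (g x)\<^sup>2)"
  have C: "C \<ge> 0" by (simp add: C_def)
  let ?D = "\<lambda>h x. (u (x + h *\<^sub>R e) - u x) / h"
  have "(\<epsilon> / 2)\<^sup>2 / (C + 1) > 0" using C \<epsilon> by simp
  then obtain \<phi> where \<phi>: "test_function \<phi>" "(LINT x|lebesgue. (\<psi> x - \<phi> x)\<^sup>2) < (\<epsilon> / 2)\<^sup>2 / (C + 1)"
    using L2_test_approximable[OF \<psi>] unfolding test_approximable_def by meson
  note p = test_function_L2[OF \<phi>(1)]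
  have err: "\<bar>LINT x|lebesgue. (?D h x - g x) * (\<psi> x - \<phi> x)\<bar> < \<epsilon> / 2" for h
  proof -
    have "(LINT x|lebesgue. (?D h x - g x)\<^sup>2) \<le> C"
      using integral_square_sum_le[OF difference_quotient_L2[OF u, of h e] L2_cmult[OF g, of "-1"]]
        difference_quotient_L2_bound[OF ug, of h] by (simp add: C_def)
    then have "(LINT x|lebesgue. (?D h x - g x)\<^sup>2) * (LINT x|lebesgue. (\<psi> x - \<phi> x)\<^sup>2)
        \<le> (C + 1) * (LINT x|lebesgue. (\<psi> x - \<phi> x)\<^sup>2)"
      by (intro mult_right_mono) auto
    also have "\<dots> < (\<epsilon> / 2)\<^sup>2"
      using \<phi>(2) C by (simp add: pos_less_divide_eq mult.commute)
    finally have "(LINT x|lebesgue. (?D h x - g x) * (\<psi> x - \<phi> x))\<^sup>2 < (\<epsilon> / 2)\<^sup>2"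
      using integral_Cauchy_Schwarz[OF L2_diff[OF difference_quotient_L2[OF u] g] L2_diff[OF \<psi> p]]
      by (rule le_less_trans[rotated])
    then show ?thesis
      using \<epsilon> by (intro power2_less_imp_less[of "\<bar>_\<bar>"]) auto
  qed
  have "((\<lambda>h. LINT x|lebesgue. ?D h x * \<phi> x) \<longlongrightarrow> (LINT x|lebesgue. g x * \<phi> x)) (at 0)"
    using difference_quotient_pairing_tendsto[OF u \<phi>(1), of e] L2_weak_derivativeD(3)[OF ug \<phi>(1)] by simp
  then have "\<forall>\<^sub>F h in at 0. dist (LINT x|lebesgue. ?D h x * \<phi> x) (LINT x|lebesgue. g x * \<phi> x) < \<epsilon> / 2"
    using \<epsilon> by (intro tendstoD) auto
  then show "\<forall>\<^sub>F h in at 0. dist (LINT x|lebesgue. ?D h x * \<psi> x) (LINT x|lebesgue. g x * \<psi> x) < \<epsilon>"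
  proof eventually_elim
    case (elim h)
    note int = L2_mult_integrable[OF difference_quotient_L2[OF u, of h e] \<psi>] L2_mult_integrable[OF g \<psi>]
      L2_mult_integrable[OF difference_quotient_L2[OF u, of h e] p] L2_mult_integrable[OF g p]
    have "(LINT x|lebesgue. (?D h x - g x) * (\<psi> x - \<phi> x))
        = (LINT x|lebesgue. (?D h x * \<psi> x - g x * \<psi> x) - (?D h x * \<phi> x - g x * \<phi> x))"
      by (simp only: left_diff_distrib right_diff_distrib)
    also have "\<dots> = ((LINT x|lebesgue. ?D h x * \<psi> x) - (LINT x|lebesgue. g x * \<psi> x))
        - ((LINT x|lebesgue. ?D h x * \<phi> x) - (LINT x|lebesgue. g x * \<phi> x))"
      using int by (simp only: Bochner_Integration.integral_diff Bochner_Integration.integrable_diff)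
    finally show ?case
      using err[of h] elim unfolding dist_real_def by linarith
  qed
qed

text \<open>The quotient of \<Phi>(u) differs from \<Phi>'(u) times the quotient of u by at most M
  \<bar>h\<bar> times the square of the latter, whose integral is bounded in h. Since \<Phi>'(u)
  \<phi> is in L2, weak convergence gives the limit of the main term. The same pairings tend to
  minus the integral of \<Phi>(u) against the derivative of \<phi>, and limits are unique.\<close>

theorem L2_weak_derivative_compose:
  assumes ug: "L2_weak_derivative e u g"
    and [measurable]: "\<Phi> \<in> borel_measurable borel" "\<Phi>' \<in> borel_measurable borel"
    and \<Phi>: "\<And>t. \<bar>\<Phi> t\<bar> \<le> L * \<bar>t\<bar>" and \<Phi>': "\<And>t. \<bar>\<Phi>' t\<bar> \<le> L"
    and remainder: "\<And>a b. \<bar>\<Phi> b - \<Phi> a - \<Phi>' a * (b - a)\<bar> \<le> M * (b - a)\<^sup>2"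
  shows "L2_weak_derivative e (\<lambda>x. \<Phi> (u x)) (\<lambda>x. \<Phi>' (u x) * g x)"
proof -
  note u = L2_weak_derivativeD(1)[OF ug] and g = L2_weak_derivativeD(2)[OF ug]
  note [measurable] = L2_measurable[OF u] L2_measurable[OF g]
  have w: "(\<lambda>x. \<Phi> (u x)) \<in> L2_space UNIV"
    by (rule L2_dominated[OF u, where C = L]) (use \<Phi> in auto)
  have w': "(\<lambda>x. \<Phi>' (u x) * f x) \<in> L2_space UNIV" if "f \<in> L2_space UNIV" for f :: "_ \<Rightarrow> real"
    by (rule L2_dominated[OF that, where C = L])
       (use \<Phi>' L2_measurable[OF that] in \<open>auto simp: abs_mult intro!: AE_I2 mult_right_mono\<close>)
  have "(LINT x|lebesgue. \<Phi> (u x) * frechet_derivative \<phi> (at x) e) = - (LINT x|lebesgue. \<Phi>' (u x) * g x * \<phi> x)"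
    if \<phi>: "test_function \<phi>" for \<phi>
  proof -
    let ?D = "\<lambda>h x. (u (x + h *\<^sub>R e) - u x) / h"
    let ?E = "\<lambda>h x. (\<Phi> (u (x + h *\<^sub>R e)) - \<Phi> (u x)) / h"
    obtain B where B: "B > 0" "\<And>x. \<bar>\<phi> x\<bar> \<le> B" using test_function_bounded[OF \<phi>] by metis
    note p = test_function_L2[OF \<phi>]
    define G where "G = (LINT x|lebesgue. (g x)\<^sup>2)"
    \<comment> \<open>Any two points at distance 1 give this.\<close>
    have M: "M \<ge> 0" using remainder[of 1 0] abs_ge_zero order_trans by fastforce
    have err: "norm ((LINT x|lebesgue. ?E h x * \<phi> x) - (LINT x|lebesgue. ?D h x * (\<Phi>' (u x) * \<phi> x))) \<le> M * B * G * \<bar>h\<bar>"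
      if "h \<noteq> 0" for h
    proof -
      have int: "integrable lebesgue (\<lambda>x. ?E h x * \<phi> x)" "integrable lebesgue (\<lambda>x. ?D h x * (\<Phi>' (u x) * \<phi> x))"
        by (intro L2_mult_integrable difference_quotient_L2 w w' u p)+
      have "norm ((LINT x|lebesgue. ?E h x * \<phi> x) - (LINT x|lebesgue. ?D h x * (\<Phi>' (u x) * \<phi> x)))
          = norm (LINT x|lebesgue. ?E h x * \<phi> x - ?D h x * (\<Phi>' (u x) * \<phi> x))"
        using int by (simp only: Bochner_Integration.integral_diff)
      also have "\<dots> \<le> (LINT x|lebesgue. norm (?E h x * \<phi> x - ?D h x * (\<Phi>' (u x) * \<phi> x)))"
        by (rule integral_norm_bound)
      also have "\<dots> \<le> (LINT x|lebesgue. M * \<bar>h\<bar> * B * (?D h x)\<^sup>2)"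
      proof (rule integral_mono)
        fix x
        define d where "d = u (x + h *\<^sub>R e) - u x"
        have "\<bar>\<Phi> (u (x + h *\<^sub>R e)) - \<Phi> (u x) - \<Phi>' (u x) * d\<bar> \<le> M * d\<^sup>2"
          unfolding d_def by (rule remainder)
        then have "\<bar>(\<Phi> (u (x + h *\<^sub>R e)) - \<Phi> (u x) - \<Phi>' (u x) * d) / h\<bar> \<le> M * d\<^sup>2 / \<bar>h\<bar>"
          unfolding abs_divide by (rule divide_right_mono) simp
        also have "M * d\<^sup>2 / \<bar>h\<bar> = M * \<bar>h\<bar> * (d / h)\<^sup>2"
          using \<open>h \<noteq> 0\<close> by (simp add: power_divide power2_eq_square field_simps)
        finally have "\<bar>(\<Phi> (u (x + h *\<^sub>R e)) - \<Phi> (u x) - \<Phi>' (u x) * d) / h\<bar> * \<bar>\<phi> x\<bar> \<le> M * \<bar>h\<bar> * (d / h)\<^sup>2 * B"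
          using B M by (intro mult_mono) auto
        moreover have "?E h x * \<phi> x - ?D h x * (\<Phi>' (u x) * \<phi> x)
            = (\<Phi> (u (x + h *\<^sub>R e)) - \<Phi> (u x) - \<Phi>' (u x) * d) / h * \<phi> x"
          using \<open>h \<noteq> 0\<close> by (simp add: d_def field_simps)
        ultimately show "norm (?E h x * \<phi> x - ?D h x * (\<Phi>' (u x) * \<phi> x)) \<le> M * \<bar>h\<bar> * B * (?D h x)\<^sup>2"
          by (simp add: d_def abs_mult mult_ac)
      next
        show "integrable lebesgue (\<lambda>x. M * \<bar>h\<bar> * B * (?D h x)\<^sup>2)"
          by (intro integrable_mult_right L2_square_integrable difference_quotient_L2 u)
      qed (use int in \<open>intro integrable_norm Bochner_Integration.integrable_diff\<close>)
      also have "\<dots> = M * \<bar>h\<bar> * B * (LINT x|lebesgue. (?D h x)\<^sup>2)" by simp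
      also have "\<dots> \<le> M * \<bar>h\<bar> * B * G"
        unfolding G_def using M B by (intro mult_left_mono difference_quotient_L2_bound[OF ug]) auto
      finally show ?thesis by (simp add: mult_ac)
    qed
    have "((\<lambda>h. (LINT x|lebesgue. ?E h x * \<phi> x) - (LINT x|lebesgue. ?D h x * (\<Phi>' (u x) * \<phi> x))) \<longlongrightarrow> 0) (at 0)"
    proof (rule Lim_null_comparison)
      show "\<forall>\<^sub>F h in at 0. norm ((LINT x|lebesgue. ?E h x * \<phi> x) - (LINT x|lebesgue. ?D h x * (\<Phi>' (u x) * \<phi> x)))
          \<le> M * B * G * \<bar>h\<bar>"
        unfolding eventually_at_filter by (intro always_eventually allI impI err)
      have "((\<lambda>h. M * B * G * \<bar>h\<bar>) \<longlongrightarrow> M * B * G * \<bar>0\<bar>) (at 0)"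
        by (intro tendsto_intros)
      then show "((\<lambda>h. M * B * G * \<bar>h\<bar>) \<longlongrightarrow> 0) (at 0)" by simp
    qed
    from tendsto_add[OF this difference_quotient_weakly_tendsto[OF ug w'[OF p]]]
    have "((\<lambda>h. LINT x|lebesgue. ?E h x * \<phi> x) \<longlongrightarrow> (LINT x|lebesgue. g x * (\<Phi>' (u x) * \<phi> x))) (at 0)"
      by simp
    from tendsto_unique[OF _ this difference_quotient_pairing_tendsto[OF w \<phi>, of e]]
    show ?thesis by (simp add: mult_ac)
  qed
  with w w'[OF g] show ?thesis by (simp add: L2_weak_derivative_def)
qed

text \<open>A translation by \<open>h e\<close> that moves the support off itself does not change \<open>v\<close>.\<close>

theorem L2_weak_derivative_zero:
  fixes v :: "'a::euclidean_space \<Rightarrow> real"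
  assumes vg: "L2_weak_derivative e v g" and g0: "AE x in lebesgue. g x = 0" and "e \<noteq> 0"
    and "bounded S" and vS: "AE x in lebesgue. x \<notin> S \<longrightarrow> v x = 0"
  shows "AE x in lebesgue. v x = 0"
proof -
  note v = L2_weak_derivativeD(1)[OF vg]
  obtain r where r: "r > 0" "\<And>x. x \<in> S \<Longrightarrow> norm x < r"
    using \<open>bounded S\<close> by (auto simp: bounded_pos_less)
  define h where "h = 2 * r / norm e"
  have he: "norm (h *\<^sub>R e) = 2 * r" using r \<open>e \<noteq> 0\<close> by (simp add: h_def)
  have d: "(\<lambda>x. v (x + h *\<^sub>R e) - v x) \<in> L2_space UNIV" by (intro L2_diff L2_shift v)
  have "AE x in lebesgue. (g x)\<^sup>2 = 0" using g0 by eventually_elim simp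
  then have "(LINT x|lebesgue. (g x)\<^sup>2) = 0" by (rule integral_eq_zero_AE)
  then have "(LINT x|lebesgue. (v (x + h *\<^sub>R e) - v x)\<^sup>2) = 0"
    using increment_L2_bound[OF vg, of h] by (simp add: antisym)
  then have "AE x in lebesgue. (v (x + h *\<^sub>R e) - v x)\<^sup>2 = 0"
    using integral_nonneg_eq_0_iff_AE[OF L2_square_integrable[OF d]] by simp
  then show ?thesis
    using vS AE_lebesgue_shift[OF vS, of "h *\<^sub>R e"]
  proof eventually_elim
    case (elim x)
    show ?case
    proof (cases "x \<in> S")
      case True
      then have "norm (x + h *\<^sub>R e) \<ge> r"
        using norm_triangle_ineq2[of "h *\<^sub>R e" "- x"] r(2)[of x] he by (simp add: add.commute)
      then have "x + h *\<^sub>R e \<notin> S" using r(2) by force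
      with elim show ?thesis by simp
    qed (use elim in simp)
  qed
qed

section \<open>The weak maximum principle\<close>

definition neg_slope :: "real \<Rightarrow> real" where
  "neg_slope t = max (-1) (min t 0)"

text \<open>The Huber function of the negative part: \<open>0\<close>, \<open>t\<^sup>2 / 2\<close> and \<open>- t - 1 / 2\<close> on \<open>t \<ge> 0\<close>,
  \<open>-1 \<le> t \<le> 0\<close> and \<open>t \<le> -1\<close>. Unlike the negative part itself it has a Lipschitz derivative.\<close>

definition neg_huber :: "real \<Rightarrow> real" where
  "neg_huber t = neg_slope t * t - (neg_slope t)\<^sup>2 / 2"

lemma neg_slope_bounds: "-1 \<le> neg_slope t" "neg_slope t \<le> 0"
  by (auto simp: neg_slope_def)

lemma neg_slope_eq_0_iff: "neg_slope t = 0 \<longleftrightarrow> t \<ge> 0"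
  by (auto simp: neg_slope_def)

lemma neg_huber_nonneg: "0 \<le> neg_huber t"
proof -
  consider "t \<ge> 0" | "-1 \<le> t" "t \<le> 0" | "t \<le> -1" by linarith
  then show ?thesis
    by cases (auto simp: neg_huber_def neg_slope_def max_def min_def power2_eq_square)
qed

lemma neg_huber_eq_0_iff: "neg_huber t = 0 \<longleftrightarrow> t \<ge> 0"
proof -
  consider "t \<ge> 0" | "-1 \<le> t" "t < 0" | "t \<le> -1" by linarith
  then show ?thesis
    by cases (auto simp: neg_huber_def neg_slope_def max_def min_def power2_eq_square)
qed

text \<open>The explicit factor 1 lets the bound unify with the constant \<open>L\<close> of the
  chain rule.\<close>

lemma neg_huber_le: "\<bar>neg_huber t\<bar> \<le> 1 * \<bar>t\<bar>"
proof -
  consider "t \<ge> 0" | "-1 \<le> t" "t \<le> 0" | "t \<le> -1" by linarith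
  then show ?thesis
  proof cases
    case 2
    then have "t * t \<le> -t" using mult_right_mono_neg[of "-1" t t] by simp
    then show ?thesis using 2 neg_huber_nonneg[of t]
      by (auto simp: neg_huber_def neg_slope_def max_def min_def power2_eq_square)
  qed (auto simp: neg_huber_def neg_slope_def max_def min_def)
qed

text \<open>Convexity: the left-hand side is the tangent to \<open>neg_huber\<close> at
  \<open>a\<close>, evaluated at \<open>b\<close>. The proof shows it for every slope
  \<open>d\<close> in [-1, 0], so \<open>neg_huber\<close> is the Legendre conjugate of d^2 / 2 on
  that interval.\<close>

lemma neg_huber_ge: "neg_slope a * b - (neg_slope a)\<^sup>2 / 2 \<le> neg_huber b"
proof -
  define d where "d = neg_slope a"
  have d: "-1 \<le> d" "d \<le> 0" by (simp_all add: d_def neg_slope_bounds)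
  consider "b \<ge> 0" | "-1 \<le> b" "b \<le> 0" | "b \<le> -1" by linarith
  then have "d * b - d\<^sup>2 / 2 \<le> neg_huber b"
  proof cases
    case 1
    then have "d * b \<le> 0" using d by (simp add: mult_nonpos_nonneg)
    moreover have "neg_huber b = 0" using 1 by (simp add: neg_huber_eq_0_iff)
    ultimately show ?thesis using zero_le_power2[of d] by linarith
  next
    case 2
    have "2 * d * b \<le> d\<^sup>2 + b\<^sup>2" by (rule sum_squares_bound)
    moreover have "neg_huber b = b\<^sup>2 / 2" using 2 by (simp add: neg_huber_def neg_slope_def power2_eq_square)
    ultimately show ?thesis by simp
  next
    case 3
    \<comment> \<open>The goal amounts to (d + 1) b \<le> (d^2 - 1) / 2, and the right-hand side
      exceeds -(d + 1) by (d + 1)^2 / 2.\<close>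
    have "(d + 1) * b \<le> - (d + 1)" using mult_left_mono[OF 3, of "d + 1"] d by simp
    moreover have "0 \<le> (d + 1)\<^sup>2" by simp
    moreover have "neg_huber b = - b - 1 / 2" using 3 by (simp add: neg_huber_def neg_slope_def)
    ultimately show ?thesis by (simp add: algebra_simps power2_eq_square)
  qed
  then show ?thesis by (simp add: d_def)
qed

text \<open>The tangent at \<open>a\<close> shows that the remainder is nonnegative; the tangent at
  \<open>b\<close> bounds it by the difference of the slopes times b - a, and
  \<open>neg_slope\<close> is 1-Lipschitz.\<close>

lemma neg_huber_remainder: "\<bar>neg_huber b - neg_huber a - neg_slope a * (b - a)\<bar> \<le> 1 * (b - a)\<^sup>2"
proof -
  define c d where "c = neg_slope b" and "d = neg_slope a"
  have "\<bar>c - d\<bar> \<le> \<bar>b - a\<bar>" by (auto simp: c_def d_def neg_slope_def)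
  then have "(c - d) * (b - a) \<le> (b - a)\<^sup>2"
    using mult_right_mono[of "\<bar>c - d\<bar>" "\<bar>b - a\<bar>" "\<bar>b - a\<bar>"] abs_ge_self[of "(c - d) * (b - a)"]
    by (simp add: abs_mult power2_eq_square)
  moreover have "neg_huber a \<ge> c * a - c\<^sup>2 / 2" "neg_huber b \<ge> d * b - d\<^sup>2 / 2"
    unfolding c_def d_def by (rule neg_huber_ge)+
  moreover have "neg_huber b = c * b - c\<^sup>2 / 2" "neg_huber a = d * a - d\<^sup>2 / 2"
    by (simp_all add: neg_huber_def c_def d_def)
  ultimately show ?thesis
    unfolding d_def[symmetric] by (simp add: algebra_simps abs_le_iff)
qed

text \<open>Monotonicity in the product form met in the numerator of the nonlocal integrand.\<close>

lemma neg_huber_antimono: "(a - b) * (neg_huber a - neg_huber b) \<le> 0"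
proof -
  have le: "neg_huber y \<le> neg_huber x" if "x \<le> y" for x y
    using neg_huber_ge[of y x] mult_left_mono_neg[OF that neg_slope_bounds(2)[of y]]
    by (simp add: neg_huber_def)
  show ?thesis
    using le[of a b] le[of b a] by (cases "a \<le> b") (auto simp: mult_nonneg_nonpos mult_nonpos_nonneg)
qed

lemma neg_slope_borel: "neg_slope \<in> borel_measurable borel"
  unfolding neg_slope_def by measurable

lemma neg_huber_borel: "neg_huber \<in> borel_measurable borel"
  unfolding neg_huber_def using neg_slope_borel by measurable

section \<open>Weak gradients: uniqueness and composition\<close>

lemma has_weak_gradient_unique:
  assumes "has_weak_gradient u G" "has_weak_gradient u G'"
  shows "AE x in lebesgue. G x = G' x"
proof -
  have int: "locally_integrable (\<lambda>x. H x $ i)" if "locally_integrable H" for H :: "real^'n \<Rightarrow> real^'n" and i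
  proof -
    have "integrable lebesgue (\<lambda>x. (indicat_real K x *\<^sub>R H x) $ i)" if "integrable lebesgue (\<lambda>x. indicat_real K x *\<^sub>R H x)" for K
      using integrable_bounded_linear[OF bounded_linear_vec_nth that] .
    then show ?thesis using that by (simp add: locally_integrable_def set_integrable_def)
  qed
  have G: "locally_integrable (\<lambda>x. G x $ i)" "locally_integrable (\<lambda>x. G' x $ i)" for i
    using assms by (auto simp: has_weak_gradient_def int)
  have "AE x in lebesgue. G x $ i - G' x $ i = 0" for i
  proof (rule locally_integrable_zero_if_test_zero)
    show "locally_integrable (\<lambda>x. G x $ i - G' x $ i)"
      using G by (auto simp: locally_integrable_def intro!: set_integral_diff)
    show "(LINT x|lebesgue. (G x $ i - G' x $ i) * \<phi> x) = 0" if "test_function \<phi>" for \<phi>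
    proof -
      have "(LINT x|lebesgue. G x $ i * \<phi> x) = (LINT x|lebesgue. G' x $ i * \<phi> x)"
        using assms that unfolding has_weak_gradient_def by fastforce
      then show ?thesis
        using locally_integrable_mult_test[OF G(1) that] locally_integrable_mult_test[OF G(2) that]
        by (simp add: left_diff_distrib)
    qed
  qed
  then have "AE x in lebesgue. \<forall>i. G x $ i - G' x $ i = 0"
    by (simp add: AE_finite_all[of UNIV, simplified] flip: all_simps)
  then show ?thesis by eventually_elim (simp add: vec_eq_iff)
qed

lemma has_weak_gradient_weak_gradient:
  assumes "has_weak_gradient u G"
  shows "has_weak_gradient u (weak_gradient u)"
  unfolding weak_gradient_def using someI[of "has_weak_gradient u", OF assms] .

lemma L2_vec_nth:
  fixes G :: "'a::euclidean_space \<Rightarrow> real^'n"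
  assumes "G \<in> L2_space UNIV"
  shows "(\<lambda>x. G x $ i) \<in> L2_space UNIV"
proof (rule L2_dominated[OF assms, where C = 1])
  show "(\<lambda>x. G x $ i) \<in> borel_measurable lebesgue"
    by (rule measurable_compose[OF L2_measurable[OF assms] borel_measurable_nth])
qed (auto simp: component_le_norm_cart)

text \<open>The three conclusions serve the final translation argument, the local term of the form,
  and the admissibility of the test function, respectively.\<close>

lemma H1_space_compose:
  fixes u :: "real^'n \<Rightarrow> real"
  assumes u: "u \<in> L2_space UNIV" and G: "has_weak_gradient u G" "G \<in> L2_space UNIV"
    and \<Phi>_borel: "\<Phi> \<in> borel_measurable borel" "\<Phi>' \<in> borel_measurable borel"
    and \<Phi>: "\<And>t. \<bar>\<Phi> t\<bar> \<le> L * \<bar>t\<bar>" "\<And>t. \<bar>\<Phi>' t\<bar> \<le> L"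
      "\<And>a b. \<bar>\<Phi> b - \<Phi> a - \<Phi>' a * (b - a)\<bar> \<le> M * (b - a)\<^sup>2"
  shows "L2_weak_derivative (axis i 1) (\<lambda>x. \<Phi> (u x)) (\<lambda>x. \<Phi>' (u x) * G x $ i)"
    and "has_weak_gradient (\<lambda>x. \<Phi> (u x)) (\<lambda>x. \<Phi>' (u x) *\<^sub>R G x)"
    and "(\<lambda>x. \<Phi> (u x)) \<in> H1_space"
proof -
  have "L2_weak_derivative (axis i 1) u (\<lambda>x. G x $ i)" for i
    using u G L2_vec_nth[OF G(2)] by (simp add: L2_weak_derivative_def has_weak_gradient_def)
  then show wd: "L2_weak_derivative (axis i 1) (\<lambda>x. \<Phi> (u x)) (\<lambda>x. \<Phi>' (u x) * G x $ i)" for i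
    using \<Phi>_borel \<Phi> by (rule L2_weak_derivative_compose)
  have L2: "(\<lambda>x. \<Phi>' (u x) *\<^sub>R G x) \<in> L2_space UNIV"
  proof (rule L2_dominated[OF G(2), where C = L])
    show "(\<lambda>x. \<Phi>' (u x) *\<^sub>R G x) \<in> borel_measurable lebesgue"
      using measurable_compose[OF L2_measurable[OF u] \<Phi>_borel(2)] L2_measurable[OF G(2)] by measurable
  qed (use \<Phi>(2) in \<open>auto intro!: AE_I2 mult_right_mono\<close>)
  show "has_weak_gradient (\<lambda>x. \<Phi> (u x)) (\<lambda>x. \<Phi>' (u x) *\<^sub>R G x)"
    using L2_weak_derivativeD(1,3)[OF wd] L2
    by (simp add: has_weak_gradient_def L2_locally_integrable)
  with L2 L2_weak_derivativeD(1)[OF wd] show "(\<lambda>x. \<Phi> (u x)) \<in> H1_space"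
    by (auto simp: H1_space_def)
qed

lemma frac_const_nonneg: "0 \<le> frac_const TYPE('n::finite) s"
  unfolding frac_const_def
  by (intro inverse_nonnegative_iff_nonnegative[THEN iffD2] integral_nonneg) auto

theorem theorem1p2:
  fixes \<Omega> :: "(real^'n) set" and s :: real and u :: "real^'n \<Rightarrow> real"
  assumes "open \<Omega>" and "bounded \<Omega>" and "C1_boundary \<Omega>"
    and "0 < s" and "s < 1"
    and "u \<in> H1_space"
    and "weakly_L_ge s \<Omega> u (\<lambda>x. 0)"
    and "AE x in lebesgue. x \<notin> \<Omega> \<longrightarrow> 0 \<le> u x"
  shows "AE x in lebesgue. x \<in> \<Omega> \<longrightarrow> 0 \<le> u x"
proof -
  obtain G where u: "u \<in> L2_space UNIV" and G: "has_weak_gradient u G" "G \<in> L2_space UNIV"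
    using \<open>u \<in> H1_space\<close> by (auto simp: H1_space_def)
  define v where "v = (\<lambda>x. neg_huber (u x))"
  define Gv where "Gv = (\<lambda>x. neg_slope (u x) *\<^sub>R G x)"
  have slope: "\<bar>neg_slope t\<bar> \<le> 1" for t using neg_slope_bounds[of t] by (simp add: abs_le_iff)
  note comp = H1_space_compose[OF u G neg_huber_borel neg_slope_borel neg_huber_le slope neg_huber_remainder,
      folded v_def Gv_def]
  \<comment> \<open>The sign of \<open>u\<close> outside \<Omega> makes \<open>v\<close> vanish
    there, hence admissible.\<close>
  have v0: "AE x in lebesgue. x \<notin> \<Omega> \<longrightarrow> v x = 0"
    using assms(8) by eventually_elim (simp add: v_def neg_huber_eq_0_iff)
  then have "v \<in> X_space \<Omega>"
    using comp(3) by (simp add: X_space_def)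
  moreover have "AE x in lebesgue. 0 \<le> v x"
    by (simp add: v_def neg_huber_nonneg)
  ultimately have form: "0 \<le> mixed_form s \<Omega> u v"
    using assms(7) unfolding weakly_L_ge_def by (auto simp: set_lebesgue_integral_def)

  \<comment> \<open>A pointwise sign passes to the Bochner integral without an integrability proof,
    as a nonintegrable function has integral 0.\<close>
  have "0 \<le> (LINT p|(lebesgue :: ((real^'n) \<times> (real^'n)) measure).
      - ((u (fst p) - u (snd p)) * (v (fst p) - v (snd p)) / norm (fst p - snd p) powr (real CARD('n) + 2 * s)))"
    unfolding v_def by (intro integral_nonneg_AE AE_I2 neg_0_le_iff_le[THEN iffD2] divide_nonpos_nonneg neg_huber_antimono) simp
  then have "(LINT p|(lebesgue :: ((real^'n) \<times> (real^'n)) measure).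
      (u (fst p) - u (snd p)) * (v (fst p) - v (snd p)) / norm (fst p - snd p) powr (real CARD('n) + 2 * s)) \<le> 0"
    by simp
  then have "frac_const TYPE('n) s / 2 * (LINT p|(lebesgue :: ((real^'n) \<times> (real^'n)) measure).
      (u (fst p) - u (snd p)) * (v (fst p) - v (snd p)) / norm (fst p - snd p) powr (real CARD('n) + 2 * s)) \<le> 0"
    using frac_const_nonneg[where 'n='n and s=s] by (intro mult_nonneg_nonpos) auto
  then have local: "0 \<le> (LINT x:\<Omega>|lebesgue. weak_gradient u x \<bullet> weak_gradient v x)"
    using form unfolding mixed_form_def by linarith

  have wu: "AE x in lebesgue. weak_gradient u x = G x"
    by (rule has_weak_gradient_unique[OF has_weak_gradient_weak_gradient[OF G(1)] G(1)])
  have wv: "AE x in lebesgue. weak_gradient v x = Gv x"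
    by (rule has_weak_gradient_unique[OF has_weak_gradient_weak_gradient[OF comp(2)] comp(2)])
  \<comment> \<open>The negated local integrand, written with the concrete gradient so that it is
    nonnegative everywhere and visibly integrable.\<close>
  let ?q = "\<lambda>x. indicat_real \<Omega> x * (- neg_slope (u x) * (norm (G x))\<^sup>2)"
  have q: "AE x in lebesgue. indicat_real \<Omega> x *\<^sub>R (weak_gradient u x \<bullet> weak_gradient v x) = - ?q x"
    using wu wv by eventually_elim (simp add: Gv_def power2_norm_eq_inner)
  have [measurable]: "u \<in> borel_measurable lebesgue" "G \<in> borel_measurable lebesgue" "neg_slope \<in> borel_measurable borel"
    using u G(2) neg_slope_borel by (auto intro: L2_measurable)
  have [measurable]: "\<Omega> \<in> sets lebesgue" using \<open>open \<Omega>\<close> by (simp add: borel_open)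
  have "integrable lebesgue (\<lambda>x. (norm (G x))\<^sup>2)" using G(2) by (simp add: L2_space_UNIV_iff)
  then have q_int: "integrable lebesgue ?q"
  proof (rule Bochner_Integration.integrable_bound)
    have "\<bar>?q x\<bar> \<le> (norm (G x))\<^sup>2" for x
      using slope[of "u x"] mult_right_mono[OF slope[of "u x"] zero_le_power2[of "norm (G x)"]]
      by (auto simp: abs_mult indicator_def)
    then show "AE x in lebesgue. norm (?q x) \<le> norm ((norm (G x))\<^sup>2)" by simp
  qed measurable
  have "(LINT x:\<Omega>|lebesgue. weak_gradient u x \<bullet> weak_gradient v x) = (LINT x|lebesgue. - ?q x)"
  proof -
    have "(\<lambda>x. - ?q x) \<in> borel_measurable lebesgue" by measurable
    \<comment> \<open>Measurability passes along an almost everywhere equality because Lebesgue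
      measure is complete.\<close>
    moreover from this have "(\<lambda>x. indicat_real \<Omega> x *\<^sub>R (weak_gradient u x \<bullet> weak_gradient v x)) \<in> borel_measurable lebesgue"
      by (rule borel_measurable_AE) (use q in eventually_elim, simp only:)
    ultimately show ?thesis
      unfolding set_lebesgue_integral_def using q by (intro integral_cong_AE) auto
  qed
  then have "(LINT x|lebesgue. ?q x) \<le> 0" using local by simp
  moreover have q_nonneg: "0 \<le> ?q x" for x
    using neg_slope_bounds(2)[of "u x"] by (intro mult_nonneg_nonneg) auto
  ultimately have "(LINT x|lebesgue. ?q x) = 0"
    by (intro antisym integral_nonneg_AE AE_I2 q_nonneg)
  then have "AE x in lebesgue. ?q x = 0"
    using integral_nonneg_eq_0_iff_AE[OF q_int] q_nonneg by simp
  \<comment> \<open>Inside \<Omega> a zero of \<open>?q\<close> is a zero of the slope or of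
    \<open>G\<close>; outside, 0 \<le> u makes the slope 0. The derivative of \<open>v\<close> thus
    vanishes on the whole space, as the translation argument requires.\<close>
  then have "AE x in lebesgue. neg_slope (u x) * G x $ i = 0" for i
    using assms(8)
  proof eventually_elim
    case (elim x)
    then show ?case
      by (cases "x \<in> \<Omega>") (auto simp: neg_slope_eq_0_iff)
  qed
  then have "AE x in lebesgue. v x = 0"
    by (rule L2_weak_derivative_zero[OF comp(1) _ _ \<open>bounded \<Omega>\<close> v0]) (simp add: axis_eq_0_iff)
  then show ?thesis
    by eventually_elim (simp add: v_def neg_huber_eq_0_iff)
qed

end
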